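(* Let $R$ be a Noetherian commutative ring and $M$ a finitely generated $R$-module. Let $$\Omega_M: M\otimes_R{}^{*}R\to{}^{*}M$$ be the $R$-homomorphism induced by the bilinear map $\omega:M\times{}^{*}R\to{}^{*}M$, $\omega(m,r)=rm$. Then $\Omega_M$ is an isomorphism.
   Context: ${}^{*}$ denotes an enlargement (a nonstandard extension satisfying transfer, in which every standard family with the finite intersection property has enlargements with a common point) of a superstructure containing $R$ and $M$. ${}^{*}R$ is the enlargement of $R$, a commutative ring containing $R$ via $a\mapsto{}^{*}a$ and thus an $R$-algebra; ${}^{*}M$ is the enlargement of $M$, a ${}^{*}R$-module containing $M$ via $m\mapsto{}^{*}m$. *)

theory Defs
  imports
    "HOL-Algebra.Module"
    "HOL-Algebra.QuotRing"
    "HOL-Algebra.Ring_Divisibility"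
    "HOL-Library.Extended_Nat"
begin

section \<open>Superstructures\<close>

text \<open>A universe consists of a membership relation on a type and a set of individuals
  (urelements).\<close>

record 'v universe =
  memb :: "'v \<Rightarrow> 'v \<Rightarrow> bool"
  indiv :: "'v set"

definition elts :: "'v universe \<Rightarrow> 'v \<Rightarrow> 'v set" where
  "elts V a = {u. memb V u a}"

primrec level :: "'v universe \<Rightarrow> nat \<Rightarrow> 'v set" where
  "level V 0 = indiv V"
| "level V (Suc n) = level V n \<union> {a. a \<notin> indiv V \<and> elts V a \<subseteq> level V n}"

text \<open>For \<open>h = \<infinity>\<close> the following says that \<open>V\<close> is (isomorphic to) the superstructure
  over its set \<open>X\<close> of individuals, that is, the union of the levels \<open>V\<^sub>0 = X\<close>,
  \<open>V\<^sub>n\<^sub>+\<^sub>1 = V\<^sub>n \<union> Pow V\<^sub>n\<close>; for finite \<open>h\<close> it says that \<open>V\<close> is its level \<open>V\<^sub>h\<close>.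
  Finite heights are admitted because the full superstructure over an infinite set is larger
  than every type that can be constructed from \<open>X\<close> in HOL, whereas each finite level
  is realised by a type.\<close>

definition superstructure :: "enat \<Rightarrow> 'v universe \<Rightarrow> bool" where
  "superstructure h V \<longleftrightarrow>
     (\<forall>x\<in>indiv V. elts V x = {}) \<and>
     (\<forall>a b. a \<notin> indiv V \<longrightarrow> b \<notin> indiv V \<longrightarrow> elts V a = elts V b \<longrightarrow> a = b) \<and>
     (\<forall>n A. enat n < h \<longrightarrow> A \<subseteq> level V n \<longrightarrow> (\<exists>a. a \<notin> indiv V \<and> elts V a = A)) \<and>
     (\<forall>a. \<exists>n. enat n \<le> h \<and> a \<in> level V n)"

definition code :: "'v universe \<Rightarrow> 'v set \<Rightarrow> 'v" where
  "code V A = (THE a. a \<notin> indiv V \<and> elts V a = A)"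

text \<open>\<open>p\<close> is the Kuratowski pair \<open>{{a}, {a, b}}\<close>, respectively the triple \<open>((a, b), c)\<close>.
  These are relations rather than functions because pairs of elements of the topmost levels
  do not exist if the height is finite.\<close>

definition is_pair :: "'v universe \<Rightarrow> 'v \<Rightarrow> 'v \<Rightarrow> 'v \<Rightarrow> bool" where
  "is_pair V p a b \<longleftrightarrow>
     (\<exists>s t. elts V p = {s, t} \<and> elts V s = {a} \<and> elts V t = {a, b})"

definition is_triple :: "'v universe \<Rightarrow> 'v \<Rightarrow> 'v \<Rightarrow> 'v \<Rightarrow> 'v \<Rightarrow> bool" where
  "is_triple V p a b c \<longleftrightarrow> (\<exists>q. is_pair V q a b \<and> is_pair V p q c)"

definition graph2 :: "'v universe \<Rightarrow> 'v set \<Rightarrow> 'v set \<Rightarrow> ('v \<Rightarrow> 'v \<Rightarrow> 'v) \<Rightarrow> 'v" where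
  "graph2 V A B f = code V {p. \<exists>a\<in>A. \<exists>b\<in>B. is_triple V p a b (f a b)}"


section \<open>Transfer and enlargements\<close>

text \<open>Bounded formulas of the language of set theory. Variables are natural numbers, and
  \<open>BAll i j \<phi>\<close> stands for \<open>\<forall>x\<^sub>i \<in> x\<^sub>j. \<phi>\<close>.
  Parameters enter through the values assigned to the free variables.\<close>

datatype bformula =
    Mem nat nat
  | Eql nat nat
  | Neg bformula
  | Conj bformula bformula
  | BAll nat nat bformula

primrec sat :: "'v universe \<Rightarrow> (nat \<Rightarrow> 'v) \<Rightarrow> bformula \<Rightarrow> bool" where
  "sat V e (Mem i j) = memb V (e i) (e j)"
| "sat V e (Eql i j) = (e i = e j)"
| "sat V e (Neg \<phi>) = (\<not> sat V e \<phi>)"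
| "sat V e (Conj \<phi> \<psi>) = (sat V e \<phi> \<and> sat V e \<psi>)"
| "sat V e (BAll i j \<phi>) = (\<forall>u\<in>elts V (e j). sat V (e(i := u)) \<phi>)"

definition transfer_principle :: "'v universe \<Rightarrow> 'w universe \<Rightarrow> ('v \<Rightarrow> 'w) \<Rightarrow> bool" where
  "transfer_principle V W star \<longleftrightarrow> (\<forall>\<phi> e. sat V e \<phi> \<longleftrightarrow> sat W (star \<circ> e) \<phi>)"

definition finite_intersection_property :: "'v universe \<Rightarrow> 'v \<Rightarrow> bool" where
  "finite_intersection_property V A \<longleftrightarrow>
     (\<forall>F. finite F \<longrightarrow> F \<noteq> {} \<longrightarrow> F \<subseteq> elts V A \<longrightarrow> (\<exists>x. \<forall>B\<in>F. x \<in> elts V B))"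

definition enlargement :: "enat \<Rightarrow> 'v universe \<Rightarrow> 'w universe \<Rightarrow> ('v \<Rightarrow> 'w) \<Rightarrow> bool" where
  "enlargement h V W star \<longleftrightarrow>
     superstructure h V \<and> superstructure h W \<and>
     (\<forall>a. star a \<in> indiv W \<longleftrightarrow> a \<in> indiv V) \<and>
     transfer_principle V W star \<and>
     (\<forall>A. finite_intersection_property V A \<longrightarrow>
        (\<exists>y. \<forall>B\<in>elts V A. y \<in> elts W (star B)))"

definition star_set :: "'v universe \<Rightarrow> 'w universe \<Rightarrow> ('v \<Rightarrow> 'w) \<Rightarrow> 'v set \<Rightarrow> 'w set" where
  "star_set V W star A = elts W (star (code V A))"

text \<open>The function whose graph is the enlargement of the graph of \<open>f\<close> on \<open>A \<times> B\<close>.\<close>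

definition star_fun2 ::
  "'v universe \<Rightarrow> 'w universe \<Rightarrow> ('v \<Rightarrow> 'w) \<Rightarrow> 'v set \<Rightarrow> 'v set \<Rightarrow> ('v \<Rightarrow> 'v \<Rightarrow> 'v)
     \<Rightarrow> 'w \<Rightarrow> 'w \<Rightarrow> 'w" where
  "star_fun2 V W star A B f x y =
     (THE z. \<exists>p\<in>elts W (star (graph2 V A B f)). is_triple W p x y z)"

definition star_ring ::
  "'v universe \<Rightarrow> 'w universe \<Rightarrow> ('v \<Rightarrow> 'w) \<Rightarrow> ('v, 'c) ring_scheme \<Rightarrow> 'w ring" where
  "star_ring V W star R =
     \<lparr>carrier = star_set V W star (carrier R),
      mult = star_fun2 V W star (carrier R) (carrier R) (mult R),
      one = star \<one>\<^bsub>R\<^esub>,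
      zero = star \<zero>\<^bsub>R\<^esub>,
      add = star_fun2 V W star (carrier R) (carrier R) (add R)\<rparr>"

text \<open>The fields \<^const>\<open>mult\<close> and \<^const>\<open>one\<close> play no role in a module, here and below.\<close>

definition star_module ::
  "'v universe \<Rightarrow> 'w universe \<Rightarrow> ('v \<Rightarrow> 'w) \<Rightarrow> ('v, 'c) ring_scheme \<Rightarrow> ('v, 'v, 'd) module_scheme
     \<Rightarrow> ('w, 'w) module" where
  "star_module V W star R M =
     \<lparr>carrier = star_set V W star (carrier M),
      mult = undefined,
      one = undefined,
      zero = star \<zero>\<^bsub>M\<^esub>,
      add = star_fun2 V W star (carrier M) (carrier M) (add M),
      smult = star_fun2 V W star (carrier R) (carrier M) (smult M)\<rparr>"


section \<open>Modules\<close>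

definition finitely_generated_module ::
  "('r, 'c) ring_scheme \<Rightarrow> ('r, 'm, 'd) module_scheme \<Rightarrow> bool" where
  "finitely_generated_module R M \<longleftrightarrow>
     (\<exists>S. finite S \<and> S \<subseteq> carrier M \<and>
        (\<forall>m\<in>carrier M. \<exists>c\<in>S \<rightarrow> carrier R. m = (\<Oplus>\<^bsub>M\<^esub>s\<in>S. c s \<odot>\<^bsub>M\<^esub> s)))"

definition module_homs ::
  "('r, 'c) ring_scheme \<Rightarrow> ('r, 'm, 'd) module_scheme \<Rightarrow> ('r, 'n, 'e) module_scheme
     \<Rightarrow> ('m \<Rightarrow> 'n) set" where
  "module_homs R M N =
     {h \<in> carrier M \<rightarrow>\<^sub>E carrier N.
        (\<forall>x\<in>carrier M. \<forall>y\<in>carrier M. h (x \<oplus>\<^bsub>M\<^esub> y) = h x \<oplus>\<^bsub>N\<^esub> h y) \<and>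
        (\<forall>r\<in>carrier R. \<forall>x\<in>carrier M. h (r \<odot>\<^bsub>M\<^esub> x) = r \<odot>\<^bsub>N\<^esub> h x)}"

definition module_isos ::
  "('r, 'c) ring_scheme \<Rightarrow> ('r, 'm, 'd) module_scheme \<Rightarrow> ('r, 'n, 'e) module_scheme
     \<Rightarrow> ('m \<Rightarrow> 'n) set" where
  "module_isos R M N = {h \<in> module_homs R M N. bij_betw h (carrier M) (carrier N)}"

definition restrict_scalars :: "('r \<Rightarrow> 's) \<Rightarrow> ('s, 'n, 'd) module_scheme \<Rightarrow> ('r, 'n) module" where
  "restrict_scalars \<phi> N =
     \<lparr>carrier = carrier N, mult = mult N, one = \<one>\<^bsub>N\<^esub>, zero = \<zero>\<^bsub>N\<^esub>, add = add N,
      smult = (\<lambda>r x. \<phi> r \<odot>\<^bsub>N\<^esub> x)\<rparr>"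

definition ring_as_module :: "('s, 'c) ring_scheme \<Rightarrow> ('s, 's) module" where
  "ring_as_module S =
     \<lparr>carrier = carrier S, mult = mult S, one = \<one>\<^bsub>S\<^esub>, zero = \<zero>\<^bsub>S\<^esub>, add = add S,
      smult = mult S\<rparr>"

definition quotient_module ::
  "('r, 'm, 'd) module_scheme \<Rightarrow> 'm set \<Rightarrow> ('r, 'm set) module" where
  "quotient_module M N =
     \<lparr>carrier = a_rcosets\<^bsub>M\<^esub> N, mult = undefined, one = undefined, zero = N, add = set_add M,
      smult = (\<lambda>r C. \<Union>x\<in>C. N +>\<^bsub>M\<^esub> (r \<odot>\<^bsub>M\<^esub> x))\<rparr>"

definition submodule_generated ::
  "('r, 'c) ring_scheme \<Rightarrow> ('r, 'm, 'd) module_scheme \<Rightarrow> 'm set \<Rightarrow> 'm set" where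
  "submodule_generated R M S = \<Inter>{N. submodule N R M \<and> S \<subseteq> N}"

definition free_module ::
  "('r, 'c) ring_scheme \<Rightarrow> 'b set \<Rightarrow> ('r, 'b \<Rightarrow> 'r) module" where
  "free_module R B =
     \<lparr>carrier = {f. (\<forall>b\<in>B. f b \<in> carrier R) \<and> (\<forall>b. b \<notin> B \<longrightarrow> f b = \<zero>\<^bsub>R\<^esub>) \<and>
                    finite {b. f b \<noteq> \<zero>\<^bsub>R\<^esub>}},
      mult = undefined,
      one = undefined,
      zero = (\<lambda>_. \<zero>\<^bsub>R\<^esub>),
      add = (\<lambda>f g b. f b \<oplus>\<^bsub>R\<^esub> g b),
      smult = (\<lambda>r f b. r \<otimes>\<^bsub>R\<^esub> f b)\<rparr>"

definition basis_elt :: "('r, 'c) ring_scheme \<Rightarrow> 'b \<Rightarrow> 'b \<Rightarrow> 'r" where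
  "basis_elt R b = (\<lambda>b'. if b' = b then \<one>\<^bsub>R\<^esub> else \<zero>\<^bsub>R\<^esub>)"


section \<open>Tensor products\<close>

definition tensor_relations ::
  "('r, 'c) ring_scheme \<Rightarrow> ('r, 'm, 'd) module_scheme \<Rightarrow> ('r, 'n, 'e) module_scheme
     \<Rightarrow> ('m \<times> 'n \<Rightarrow> 'r) set" where
  "tensor_relations R M N =
     (let F = free_module R (carrier M \<times> carrier N); e = basis_elt R in
       {e (m \<oplus>\<^bsub>M\<^esub> m', n) \<ominus>\<^bsub>F\<^esub> (e (m, n) \<oplus>\<^bsub>F\<^esub> e (m', n)) | m m' n.
          m \<in> carrier M \<and> m' \<in> carrier M \<and> n \<in> carrier N} \<union>
       {e (m, n \<oplus>\<^bsub>N\<^esub> n') \<ominus>\<^bsub>F\<^esub> (e (m, n) \<oplus>\<^bsub>F\<^esub> e (m, n')) | m n n'.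
          m \<in> carrier M \<and> n \<in> carrier N \<and> n' \<in> carrier N} \<union>
       {e (r \<odot>\<^bsub>M\<^esub> m, n) \<ominus>\<^bsub>F\<^esub> (r \<odot>\<^bsub>F\<^esub> e (m, n)) | r m n.
          r \<in> carrier R \<and> m \<in> carrier M \<and> n \<in> carrier N} \<union>
       {e (m, r \<odot>\<^bsub>N\<^esub> n) \<ominus>\<^bsub>F\<^esub> (r \<odot>\<^bsub>F\<^esub> e (m, n)) | r m n.
          r \<in> carrier R \<and> m \<in> carrier M \<and> n \<in> carrier N})"

definition tensor_submodule ::
  "('r, 'c) ring_scheme \<Rightarrow> ('r, 'm, 'd) module_scheme \<Rightarrow> ('r, 'n, 'e) module_scheme
     \<Rightarrow> ('m \<times> 'n \<Rightarrow> 'r) set" where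
  "tensor_submodule R M N =
     submodule_generated R (free_module R (carrier M \<times> carrier N)) (tensor_relations R M N)"

definition tensor_product ::
  "('r, 'c) ring_scheme \<Rightarrow> ('r, 'm, 'd) module_scheme \<Rightarrow> ('r, 'n, 'e) module_scheme
     \<Rightarrow> ('r, ('m \<times> 'n \<Rightarrow> 'r) set) module" where
  "tensor_product R M N =
     quotient_module (free_module R (carrier M \<times> carrier N)) (tensor_submodule R M N)"

definition pure_tensor ::
  "('r, 'c) ring_scheme \<Rightarrow> ('r, 'm, 'd) module_scheme \<Rightarrow> ('r, 'n, 'e) module_scheme
     \<Rightarrow> 'm \<Rightarrow> 'n \<Rightarrow> ('m \<times> 'n \<Rightarrow> 'r) set" where
  "pure_tensor R M N m n =
     tensor_submodule R M N +>\<^bsub>free_module R (carrier M \<times> carrier N)\<^esub> basis_elt R (m, n)"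

text \<open>The homomorphism on the tensor product that is induced by a bilinear map \<open>\<beta>\<close>;
  uniqueness uses that \<^const>\<open>module_homs\<close> contains extensional functions only.\<close>

definition induced_hom ::
  "('r, 'c) ring_scheme \<Rightarrow> ('r, 'm, 'd) module_scheme \<Rightarrow> ('r, 'n, 'e) module_scheme
     \<Rightarrow> ('r, 'p, 'f) module_scheme \<Rightarrow> ('m \<Rightarrow> 'n \<Rightarrow> 'p) \<Rightarrow> ('m \<times> 'n \<Rightarrow> 'r) set \<Rightarrow> 'p" where
  "induced_hom R M N P \<beta> =
     (THE h. h \<in> module_homs R (tensor_product R M N) P \<and>
        (\<forall>m\<in>carrier M. \<forall>n\<in>carrier N. h (pure_tensor R M N m n) = \<beta> m n))"


section \<open>The comparison map\<close>

definition star_ring_mod ::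
  "'v universe \<Rightarrow> 'w universe \<Rightarrow> ('v \<Rightarrow> 'w) \<Rightarrow> ('v, 'c) ring_scheme \<Rightarrow> ('v, 'w) module" where
  "star_ring_mod V W star R = restrict_scalars star (ring_as_module (star_ring V W star R))"

definition star_module_mod ::
  "'v universe \<Rightarrow> 'w universe \<Rightarrow> ('v \<Rightarrow> 'w) \<Rightarrow> ('v, 'c) ring_scheme \<Rightarrow> ('v, 'v, 'd) module_scheme
     \<Rightarrow> ('v, 'w) module" where
  "star_module_mod V W star R M = restrict_scalars star (star_module V W star R M)"

definition omega ::
  "'v universe \<Rightarrow> 'w universe \<Rightarrow> ('v \<Rightarrow> 'w) \<Rightarrow> ('v, 'c) ring_scheme \<Rightarrow> ('v, 'v, 'd) module_scheme
     \<Rightarrow> 'v \<Rightarrow> 'w \<Rightarrow> 'w" where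
  "omega V W star R M m r = r \<odot>\<^bsub>star_module V W star R M\<^esub> star m"

definition Omega ::
  "'v universe \<Rightarrow> 'w universe \<Rightarrow> ('v \<Rightarrow> 'w) \<Rightarrow> ('v, 'c) ring_scheme \<Rightarrow> ('v, 'v, 'd) module_scheme
     \<Rightarrow> ('v \<times> 'w \<Rightarrow> 'v) set \<Rightarrow> 'w" where
  "Omega V W star R M =
     induced_hom R M (star_ring_mod V W star R) (star_module_mod V W star R M)
       (omega V W star R M)"

text \<open>A superstructure of height \<open>h\<close> contains \<open>R\<close> and \<open>M\<close> if their elements occur in some
  level \<open>k\<close> and the carriers and the graphs of the operations are again elements. As these
  graphs are sets of pairs \<open>((a, b), c)\<close> and each Kuratowski pair raises the level by two,
  this takes five further levels; the condition on \<open>h\<close> is void for \<open>h = \<infinity>\<close>.\<close>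

definition contains_ring_and_module ::
  "enat \<Rightarrow> 'v universe \<Rightarrow> ('v, 'c) ring_scheme \<Rightarrow> ('v, 'v, 'd) module_scheme \<Rightarrow> bool" where
  "contains_ring_and_module h V R M \<longleftrightarrow>
     (\<exists>k. enat (k + 5) \<le> h \<and> carrier R \<subseteq> level V k \<and> carrier M \<subseteq> level V k)"

end

theory Submission
  imports Defs
begin

text \<open>By transfer, the laws of \<open>R\<close> and \<open>M\<close> pass to \<open>*R\<close> and \<open>*M\<close>, and \<open>*(N + R g) = *N + *R g\<close>
  for standard \<open>N\<close>; hence the enlargement of the span of a finite set \<open>S\<close> is the \<open>*R\<close>-span of
  \<open>S\<close>. For generators of \<open>M\<close> this is surjectivity.

  Injectivity does not need a finite presentation of \<open>M\<close>: one shows by induction on \<open>S\<close> that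
  \<open>\<Sum>\<^sub>s r\<^sub>s s = 0\<close> in \<open>*M\<close> implies \<open>\<Sum>\<^sub>s s \<otimes> r\<^sub>s = 0\<close>. For \<open>S \<union> {g}\<close> the coefficient \<open>r\<^sub>g\<close> lies in
  \<open>*I\<close>, where \<open>I\<close> is the ideal of all \<open>a\<close> with \<open>a g\<close> in the span of \<open>S\<close>. As \<open>R\<close> is Noetherian, \<open>I\<close>
  is the span of a finite set \<open>A\<close>, so \<open>r\<^sub>g = \<Sum>\<^sub>a c\<^sub>a a\<close> and \<open>g \<otimes> r\<^sub>g = \<Sum>\<^sub>a a g \<otimes> c\<^sub>a\<close>, which moves the last
  summand into the span of \<open>S\<close>.\<close>

section \<open>Bounded formulas and transfer\<close>

text \<open>No sum of variable length is transferred: that would require finite sequences as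
  elements of the universes. A span is instead built by steps N + R g, each of which is a bounded
  formula in the graphs of addition and scalar multiplication. Formulas have no function symbols, so
  an operation enters through its coded graph and every intermediate value has to be named by a
  bounded quantifier.

  The same step, applied to R as a module over itself, shows that *I is the *R-span of the finite
  set A. This is the delicate point: if an ideal I is not finitely generated, the sets I - J, with J
  a finitely generated ideal inside I, have the finite intersection property, and *I has an element
  outside the *R-span of I.

  Transfer and algebra meet in the condition \<open>colon\<close> of \<open>base_change\<close>;
  what follows from it is argued for an arbitrary ring homomorphism. There, the shortened relation
  obtained by removing a generator is again a relation because the long and the short tensor sum are
  equal and Omega sends them to the two sums in *M.\<close>

definition BEx :: "nat \<Rightarrow> nat \<Rightarrow> bformula \<Rightarrow> bformula" where
  "BEx i j \<phi> = Neg (BAll i j (Neg \<phi>))"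

definition Disj :: "bformula \<Rightarrow> bformula \<Rightarrow> bformula" where
  "Disj \<phi> \<psi> = Neg (Conj (Neg \<phi>) (Neg \<psi>))"

definition Imp :: "bformula \<Rightarrow> bformula \<Rightarrow> bformula" where
  "Imp \<phi> \<psi> = Neg (Conj \<phi> (Neg \<psi>))"

lemma sat_BEx [simp]: "sat V e (BEx i j \<phi>) \<longleftrightarrow> (\<exists>u\<in>elts V (e j). sat V (e(i := u)) \<phi>)"
  by (simp add: BEx_def)

lemma sat_Disj [simp]: "sat V e (Disj \<phi> \<psi>) \<longleftrightarrow> sat V e \<phi> \<or> sat V e \<psi>"
  by (simp add: Disj_def)

lemma sat_Imp [simp]: "sat V e (Imp \<phi> \<psi>) \<longleftrightarrow> (sat V e \<phi> \<longrightarrow> sat V e \<psi>)"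
  by (simp add: Imp_def)

text \<open>In the following three formulas the variables below \<open>3\<close>, \<open>5\<close> and \<open>6\<close>, respectively,
  are bound, so that the arguments have to be larger.\<close>

definition Pair_fm :: "nat \<Rightarrow> nat \<Rightarrow> nat \<Rightarrow> bformula" where
  "Pair_fm p a b = BEx 0 p (BEx 1 p
     (Conj (BAll 2 p (Disj (Eql 2 0) (Eql 2 1)))
     (Conj (Conj (Mem a 0) (BAll 2 0 (Eql 2 a)))
     (Conj (Conj (Mem a 1) (Mem b 1)) (BAll 2 1 (Disj (Eql 2 a) (Eql 2 b)))))))"

definition Triple_fm :: "nat \<Rightarrow> nat \<Rightarrow> nat \<Rightarrow> nat \<Rightarrow> bformula" where
  "Triple_fm p a b c = BEx 3 p (BEx 4 3 (Conj (Pair_fm 4 a b) (Pair_fm p 4 c)))"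

definition App_fm :: "nat \<Rightarrow> nat \<Rightarrow> nat \<Rightarrow> nat \<Rightarrow> bformula" where
  "App_fm g a b c = BEx 5 g (Triple_fm 5 a b c)"

lemma sat_Pair_fm [simp]:
  assumes "2 < p" "2 < a" "2 < b"
  shows "sat V e (Pair_fm p a b) \<longleftrightarrow> is_pair V (e p) (e a) (e b)"
proof -
  have "sat V e (Pair_fm p a b) \<longleftrightarrow> (\<exists>s\<in>elts V (e p). \<exists>t\<in>elts V (e p).
      (\<forall>u\<in>elts V (e p). u = s \<or> u = t) \<and> (e a \<in> elts V s \<and> (\<forall>u\<in>elts V s. u = e a)) \<and>
      (e a \<in> elts V t \<and> e b \<in> elts V t) \<and> (\<forall>u\<in>elts V t. u = e a \<or> u = e b))"
    using assms by (simp add: Pair_fm_def elts_def)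
  also have "\<dots> \<longleftrightarrow> is_pair V (e p) (e a) (e b)"
    unfolding is_pair_def
  proof safe
    fix s t
    assume "s \<in> elts V (e p)" "t \<in> elts V (e p)" "\<forall>u\<in>elts V (e p). u = s \<or> u = t"
      "e a \<in> elts V s" "\<forall>u\<in>elts V s. u = e a"
      "e a \<in> elts V t" "e b \<in> elts V t" "\<forall>u\<in>elts V t. u = e a \<or> u = e b"
    then have "elts V (e p) = {s, t} \<and> elts V s = {e a} \<and> elts V t = {e a, e b}"
      by blast
    then show "\<exists>s t. elts V (e p) = {s, t} \<and> elts V s = {e a} \<and> elts V t = {e a, e b}"
      by blast
  next
    fix s t
    assume "elts V (e p) = {s, t}" "elts V s = {e a}" "elts V t = {e a, e b}"
    then show "\<exists>s\<in>elts V (e p). \<exists>t\<in>elts V (e p).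
      (\<forall>u\<in>elts V (e p). u = s \<or> u = t) \<and> (e a \<in> elts V s \<and> (\<forall>u\<in>elts V s. u = e a)) \<and>
      (e a \<in> elts V t \<and> e b \<in> elts V t) \<and> (\<forall>u\<in>elts V t. u = e a \<or> u = e b)"
      by (intro bexI[of _ s] bexI[of _ t]) auto
  qed
  finally show ?thesis .
qed

text \<open>\<open>Triple_fm\<close> may quantify \<open>q\<close> only over a set, so it runs
  through the elements of elements of \<open>p\<close>. This loses no \<open>q\<close>, since the
  code of {q} is an element of the Kuratowski pair.\<close>

lemma is_pair_witness: "is_pair V p q c \<Longrightarrow> \<exists>s\<in>elts V p. q \<in> elts V s"
  by (auto simp: is_pair_def)

lemma sat_Triple_fm [simp]:
  assumes "4 < p" "4 < a" "4 < b" "4 < c"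
  shows "sat V e (Triple_fm p a b c) \<longleftrightarrow> is_triple V (e p) (e a) (e b) (e c)"
  using assms is_pair_witness[of V "e p" _ "e c"]
  by (fastforce simp: Triple_fm_def is_triple_def)

lemma sat_App_fm [simp]:
  assumes "5 < g" "5 < a" "5 < b" "5 < c"
  shows "sat V e (App_fm g a b c) \<longleftrightarrow> (\<exists>p\<in>elts V (e g). is_triple V p (e a) (e b) (e c))"
  using assms by (simp add: App_fm_def)

text \<open>Only the element sets of \<open>p\<close> and of its elements enter, so the argument
  works for any membership relation. It is later applied in \<open>W\<close>, about which the locale
  \<open>star_map\<close> provides just transfer.\<close>

lemma is_pair_inject: "is_pair V p a b \<Longrightarrow> is_pair V p a' b' \<Longrightarrow> a = a' \<and> b = b'"
  unfolding is_pair_def by (metis doubleton_eq_iff insertI1 singletonD insert_absorb2)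

lemma is_triple_inject:
  assumes "is_triple V p a b c" "is_triple V p a' b' c'"
  shows "a = a' \<and> b = b' \<and> c = c'"
proof -
  from assms obtain q q' where "is_pair V q a b" "is_pair V p q c" "is_pair V q' a' b'" "is_pair V p q' c'"
    by (auto simp: is_triple_def)
  then show ?thesis
    using is_pair_inject[of V p q c q' c'] is_pair_inject[of V q a b a' b'] by auto
qed

lemma level_mono: "m \<le> n \<Longrightarrow> level V m \<subseteq> level V n"
  by (rule lift_Suc_mono_le) auto

section \<open>Codes, pairs and graphs in a superstructure of bounded height\<close>

context
  fixes h :: enat and V :: "'v universe"
  assumes V: "superstructure h V"
begin

lemma code_exists:
  assumes "A \<subseteq> level V n" "enat n < h"
  obtains a where "a \<notin> indiv V" "elts V a = A" "a \<in> level V (Suc n)"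
proof -
  from V assms obtain a where a: "a \<notin> indiv V" "elts V a = A"
    unfolding superstructure_def by blast
  with assms(1) have "a \<in> level V (Suc n)" by simp
  with a that show thesis by blast
qed

lemma elts_code:
  assumes "A \<subseteq> level V n" "enat n < h"
  shows "elts V (code V A) = A"
proof -
  have "\<exists>!a. a \<notin> indiv V \<and> elts V a = A"
    using code_exists[OF assms] V unfolding superstructure_def by metis
  from theI'[OF this] show ?thesis by (simp add: code_def)
qed

text \<open>\<open>p\<close> codes a subset of level \<open>n + 1\<close>, where the codes of {a}
  and {a, b} live; hence the strict bound on \<open>n + 1\<close>.\<close>

lemma ex_is_pair:
  assumes "a \<in> level V n" "b \<in> level V n" "enat (Suc n) < h"
  obtains p where "is_pair V p a b" "p \<in> level V (n + 2)"
proof -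
  have n: "enat n < h" using assms(3) by (cases h) auto
  obtain s where s: "elts V s = {a}" "s \<in> level V (Suc n)"
    using code_exists[of "{a}" n] assms n by auto
  obtain t where t: "elts V t = {a, b}" "t \<in> level V (Suc n)"
    using code_exists[of "{a, b}" n] assms n by auto
  obtain p where "elts V p = {s, t}" "p \<in> level V (Suc (Suc n))"
    using code_exists[of "{s, t}" "Suc n"] assms(3) s(2) t(2) by (metis empty_subsetI insert_subset)
  with s t that show thesis by (simp add: is_pair_def del: level.simps) blast
qed

text \<open>Individuals have no elements, so an object with an element is no individual and the
  second clause of \<open>level\<close> applies.\<close>

lemma level_SucI: "elts V p \<subseteq> level V n \<Longrightarrow> elts V p \<noteq> {} \<Longrightarrow> p \<in> level V (Suc n)"
  using V by (auto simp: superstructure_def)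

text \<open>\<open>graph2\<close> collects every \<open>p\<close> that represents a triple, not only
  those constructed by \<open>ex_is_pair\<close>. An arbitrary representative must therefore be
  confined to a level before \<open>elts_code\<close> can be applied.\<close>

lemma is_pair_level:
  assumes "is_pair V p a b" "a \<in> level V n" "b \<in> level V n"
  shows "p \<in> level V (n + 2)"
proof -
  from assms obtain s t where "elts V p = {s, t}" "elts V s = {a}" "elts V t = {a, b}"
    by (auto simp: is_pair_def)
  then show ?thesis
    using level_SucI[of s n] level_SucI[of t n] level_SucI[of p "Suc n"] assms by auto
qed

lemma ex_is_triple:
  assumes "a \<in> level V n" "b \<in> level V n" "c \<in> level V n" "enat (n + 3) < h"
  obtains p where "is_triple V p a b c" "p \<in> level V (n + 4)"
proof -
  have "enat (Suc n) < h" using assms(4) by (cases h) auto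
  then obtain q where q: "is_pair V q a b" "q \<in> level V (n + 2)"
    using ex_is_pair assms by metis
  have "c \<in> level V (n + 2)" using assms level_mono[of n "n + 2" V] by auto
  moreover have "enat (Suc (n + 2)) < h" using assms(4) by (simp add: numeral_eq_Suc)
  ultimately obtain p where "is_pair V p q c" "p \<in> level V (n + 4)"
    using ex_is_pair[of q "n + 2" c] q by (auto simp: numeral_eq_Suc)
  with q that show thesis by (auto simp: is_triple_def)
qed

lemma is_triple_level:
  assumes "is_triple V p a b c" "a \<in> level V n" "b \<in> level V n" "c \<in> level V n"
  shows "p \<in> level V (n + 4)"
proof -
  from assms obtain q where q: "is_pair V q a b" "is_pair V p q c"
    by (auto simp: is_triple_def)
  have "c \<in> level V (n + 2)" using assms level_mono[of n "n + 2" V] by auto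
  then show ?thesis
    using is_pair_level[OF q(1)] is_pair_level[OF q(2), of "n + 2"] assms by (simp add: numeral_eq_Suc)
qed

lemma graph2_iff:
  assumes "A \<subseteq> level V k" "B \<subseteq> level V k" "\<And>a b. a \<in> A \<Longrightarrow> b \<in> B \<Longrightarrow> f a b \<in> level V k"
    and k: "enat (k + 5) \<le> h"
  shows "p \<in> elts V (graph2 V A B f) \<longleftrightarrow> (\<exists>a\<in>A. \<exists>b\<in>B. is_triple V p a b (f a b))"
proof -
  have "{p. \<exists>a\<in>A. \<exists>b\<in>B. is_triple V p a b (f a b)} \<subseteq> level V (k + 4)"
    using assms is_triple_level by blast
  moreover have "enat (k + 4) < h" using k by (cases h) auto
  ultimately show ?thesis
    using elts_code by (auto simp: graph2_def)
qed

text \<open>Injectivity of triples gives one direction. The converse needs in addition that some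
  object represents the triple at all, which the height guarantees.\<close>

lemma App_graph2:
  assumes "A \<subseteq> level V k" "B \<subseteq> level V k" "\<And>a b. a \<in> A \<Longrightarrow> b \<in> B \<Longrightarrow> f a b \<in> level V k"
    and k: "enat (k + 5) \<le> h"
  shows "(\<exists>p\<in>elts V (graph2 V A B f). is_triple V p x y z) \<longleftrightarrow> x \<in> A \<and> y \<in> B \<and> z = f x y"
proof
  assume "\<exists>p\<in>elts V (graph2 V A B f). is_triple V p x y z"
  then show "x \<in> A \<and> y \<in> B \<and> z = f x y"
    by (auto simp: graph2_iff[of A k B f, OF assms] dest: is_triple_inject)
next
  assume *: "x \<in> A \<and> y \<in> B \<and> z = f x y"
  have "enat (k + 3) < h" using k by (cases h) auto
  then obtain p where "is_triple V p x y z"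
    using ex_is_triple[of x k y z] * assms by (metis subsetD)
  then show "\<exists>p\<in>elts V (graph2 V A B f). is_triple V p x y z"
    using * graph2_iff[of A k B f, OF assms] by blast
qed

end

section \<open>Enlargements of sets and of binary operations\<close>

locale star_map =
  fixes h :: enat and V :: "'v universe" and W :: "'w universe" and star :: "'v \<Rightarrow> 'w" and k :: nat
  assumes superstr: "superstructure h V" and transfer: "transfer_principle V W star"
    and k: "enat (k + 5) \<le> h"
begin

abbreviation st :: "'v set \<Rightarrow> 'w set" where "st \<equiv> star_set V W star"

lemma sat_star: "sat V e \<phi> \<longleftrightarrow> sat W (star \<circ> e) \<phi>"
  using transfer by (simp add: transfer_principle_def)

lemma elts_code_k: "A \<subseteq> level V k \<Longrightarrow> elts V (code V A) = A"
  using elts_code[OF superstr, of A k] k by (cases h) auto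

lemma star_mem_iff: "A \<subseteq> level V k \<Longrightarrow> star x \<in> st A \<longleftrightarrow> x \<in> A"
  using sat_star[of "(\<lambda>_. x)(0 := code V A)" "Mem 1 0"] elts_code_k[of A]
  by (auto simp: star_set_def elts_def)

text \<open>The level bounds ensure that the three sets have codes, which serve as quantifier
  bounds, and that the graph of \<open>f\<close> exists in a universe of height at least
  \<open>k + 5\<close>.\<close>

definition op_on :: "'v set \<Rightarrow> 'v set \<Rightarrow> 'v set \<Rightarrow> ('v \<Rightarrow> 'v \<Rightarrow> 'v) \<Rightarrow> bool" where
  "op_on A B C f \<longleftrightarrow> A \<subseteq> level V k \<and> B \<subseteq> level V k \<and> C \<subseteq> level V k \<and> (\<forall>a\<in>A. \<forall>b\<in>B. f a b \<in> C)"

lemma op_onD: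
  assumes "op_on A B C f"
  shows "A \<subseteq> level V k" "B \<subseteq> level V k" "C \<subseteq> level V k" "a \<in> A \<Longrightarrow> b \<in> B \<Longrightarrow> f a b \<in> C"
  using assms by (auto simp: op_on_def)

lemma App_V:
  assumes "op_on A B C f"
  shows "(\<exists>p\<in>elts V (graph2 V A B f). is_triple V p x y z) \<longleftrightarrow> x \<in> A \<and> y \<in> B \<and> z = f x y"
  by (rule App_graph2[OF superstr _ _ _ k]) (use assms in \<open>auto simp: op_on_def\<close>)

text \<open>\<open>star_fun2\<close> is a definite description, so existence and uniqueness of the
  value are transferred. The transferred uniqueness compares only elements of *C. A third formula
  therefore says that each member of the graph is a triple over \<open>A\<close>, \<open>B\<close>
  and \<open>C\<close>; with injectivity of triples it puts every value into *C. From here on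
  \<open>App_fm\<close> evaluates in \<open>W\<close> to an equation for
  \<open>star_fun2\<close>.\<close>

lemma star_fun2_App:
  assumes f: "op_on A B C f" and x: "x \<in> st A" and y: "y \<in> st B"
  shows star_fun2_closed: "star_fun2 V W star A B f x y \<in> st C"
    and App_W: "(\<exists>p\<in>elts W (star (graph2 V A B f)). is_triple W p x y z) \<longleftrightarrow> z = star_fun2 V W star A B f x y"
proof -
  note AV = App_V[OF f] and [simp] = op_onD(1-3)[OF f, THEN elts_code_k]
  let ?T = "\<lambda>x y z. \<exists>p\<in>elts W (star (graph2 V A B f)). is_triple W p x y z"
  \<comment> \<open>Parameters start at 6 because \<open>App_fm\<close> binds the variables up to 5.
    The default value of the assignment is the graph, which is what variable 9 denotes
    below.\<close>
  define e where "e = (\<lambda>_::nat. graph2 V A B f)(6 := code V A, 7 := code V B, 8 := code V C)"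
  have "sat V e (BAll 10 6 (BAll 11 7 (BEx 12 8 (App_fm 9 10 11 12))))"
    using op_onD(4)[OF f] by (simp add: e_def AV)
  then have ex: "\<exists>z\<in>st C. ?T x y z"
    using x y unfolding sat_star by (simp add: e_def star_set_def)
  have "sat V e (BAll 10 6 (BAll 11 7 (BAll 12 8 (BAll 13 8 (Imp (App_fm 9 10 11 12) (Imp (App_fm 9 10 11 13) (Eql 12 13)))))))"
    by (simp add: e_def AV)
  then have uniq: "z = z'" if "z \<in> st C" "z' \<in> st C" "?T x y z" "?T x y z'" for z z'
    using x y that unfolding sat_star by (simp add: e_def star_set_def)
  have "sat V e (BAll 13 9 (BEx 10 6 (BEx 11 7 (BEx 12 8 (Triple_fm 13 10 11 12)))))"
    using op_onD(4)[OF f] op_onD(1-3)[OF f]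
    by (auto simp: e_def graph2_iff[OF superstr _ _ _ k] subset_eq) blast
  then have "p \<in> elts W (star (graph2 V A B f)) \<Longrightarrow> \<exists>x\<in>st A. \<exists>y\<in>st B. \<exists>z\<in>st C. is_triple W p x y z" for p
    unfolding sat_star by (simp add: e_def star_set_def)
  then have mem: "?T x y z \<Longrightarrow> z \<in> st C" for z
    using is_triple_inject by metis
  have *: "\<exists>!z. ?T x y z" using ex uniq mem by blast
  from theI'[OF *] have T: "?T x y (star_fun2 V W star A B f x y)" by (simp add: star_fun2_def)
  then show "star_fun2 V W star A B f x y \<in> st C" using mem by blast
  show "?T x y z \<longleftrightarrow> z = star_fun2 V W star A B f x y" using T * by blast
qed

lemma star_fun2_star:
  assumes f: "op_on A B C f" and "x \<in> A" "y \<in> B"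
  shows "star_fun2 V W star A B f (star x) (star y) = star (f x y)"
proof -
  let ?e = "(\<lambda>_. graph2 V A B f)(7 := x, 8 := y, 9 := f x y)"
  have "sat V ?e (App_fm 6 7 8 9)" using App_V[OF f] assms by simp
  then have "sat W (star \<circ> ?e) (App_fm 6 7 8 9)" by (simp only: sat_star)
  moreover have "star x \<in> st A" "star y \<in> st B"
    using assms star_mem_iff by (auto simp: op_on_def)
  ultimately show ?thesis using App_W[OF f] by auto
qed

text \<open>Four separate operations let one transfer serve for associativity of addition and of
  multiplication and for the module law (a b) x = a (b x).\<close>

lemma star_fun2_assoc:
  assumes f: "op_on D C E f" "op_on A B D f'" "op_on A G E f''" "op_on B C G f'''"
    and V: "\<And>x y z. x \<in> A \<Longrightarrow> y \<in> B \<Longrightarrow> z \<in> C \<Longrightarrow> f (f' x y) z = f'' x (f''' y z)"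
    and xyz: "x \<in> st A" "y \<in> st B" "z \<in> st C"
  shows "star_fun2 V W star D C f (star_fun2 V W star A B f' x y) z =
    star_fun2 V W star A G f'' x (star_fun2 V W star B C f''' y z)"
proof -
  note [simp] = f[THEN op_onD(1), THEN elts_code_k] f[THEN op_onD(2), THEN elts_code_k]
    f[THEN op_onD(3), THEN elts_code_k]
  define e where "e = (\<lambda>_::nat. code V A)(7 := code V B, 8 := code V C, 9 := code V D, 10 := code V E,
    11 := code V G, 12 := graph2 V D C f, 13 := graph2 V A B f', 14 := graph2 V A G f'', 15 := graph2 V B C f''')"
  \<comment> \<open>Each intermediate value gets its own existential variable, bounded by the set in
    which it lies. The parameters end at 15 and the bound variables start at 20.\<close>
  define \<phi> where "\<phi> = BAll 20 6 (BAll 21 7 (BAll 22 8 (BEx 23 9 (Conj (App_fm 13 20 21 23)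
    (BEx 24 11 (Conj (App_fm 15 21 22 24)
    (BEx 25 10 (Conj (App_fm 12 23 22 25) (App_fm 14 20 24 25)))))))))"
  have "sat V e \<phi>"
    using f[THEN op_onD(4)] V by (simp add: e_def \<phi>_def f[THEN App_V])
  then have "sat W (star \<circ> e) \<phi>" by (simp only: sat_star)
  then show ?thesis
    using xyz by (simp add: e_def \<phi>_def f[THEN App_W] f[THEN star_fun2_closed] star_set_def[symmetric])
qed

lemma star_fun2_comm:
  assumes f: "op_on A A B f"
    and V: "\<And>x y. x \<in> A \<Longrightarrow> y \<in> A \<Longrightarrow> f x y = f y x"
    and xy: "x \<in> st A" "y \<in> st A"
  shows "star_fun2 V W star A A f x y = star_fun2 V W star A A f y x"
proof -
  note [simp] = f[THEN op_onD(1), THEN elts_code_k] f[THEN op_onD(3), THEN elts_code_k]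
  define e where "e = (\<lambda>_::nat. code V A)(7 := code V B, 8 := graph2 V A A f)"
  define \<phi> where "\<phi> = BAll 20 6 (BAll 21 6 (BEx 22 7 (Conj (App_fm 8 20 21 22) (App_fm 8 21 20 22))))"
  have "sat V e \<phi>"
    using f[THEN op_onD(4)] V by (simp add: e_def \<phi>_def f[THEN App_V])
  then have "sat W (star \<circ> e) \<phi>" by (simp only: sat_star)
  then show ?thesis
    using xy by (auto simp: e_def \<phi>_def f[THEN App_W] star_set_def[symmetric])
qed

text \<open>With \<open>A\<close> different from \<open>B\<close> this covers 1 x = x in a module,
  besides the neutral elements of addition and multiplication.\<close>

lemma star_fun2_unit:
  assumes f: "op_on A B B f" and u: "u \<in> A"
    and V: "\<And>x. x \<in> B \<Longrightarrow> f u x = x"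
    and x: "x \<in> st B"
  shows "star_fun2 V W star A B f (star u) x = x"
proof -
  note [simp] = f[THEN op_onD(2), THEN elts_code_k]
  define e where "e = (\<lambda>_::nat. u)(7 := code V B, 8 := graph2 V A B f)"
  define \<phi> where "\<phi> = BAll 20 7 (App_fm 8 6 20 20)"
  have "sat V e \<phi>"
    using u V by (simp add: e_def \<phi>_def f[THEN App_V])
  then have "sat W (star \<circ> e) \<phi>" by (simp only: sat_star)
  moreover have "star u \<in> st A" using u star_mem_iff f[THEN op_onD(1)] by simp
  ultimately show ?thesis
    using x by (auto simp: e_def \<phi>_def f[THEN App_W] star_set_def[symmetric])
qed

lemma star_fun2_inverse:
  assumes f: "op_on A A B f"
    and V: "\<And>x. x \<in> A \<Longrightarrow> \<exists>y\<in>A. f y x = u"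
    and x: "x \<in> st A"
  shows "\<exists>y\<in>st A. star_fun2 V W star A A f y x = star u"
proof -
  note [simp] = f[THEN op_onD(1), THEN elts_code_k]
  define e where "e = (\<lambda>_::nat. u)(7 := code V A, 8 := graph2 V A A f)"
  define \<phi> where "\<phi> = BAll 20 7 (BEx 21 7 (App_fm 8 21 20 6))"
  have "sat V e \<phi>"
    using V by (auto simp: e_def \<phi>_def f[THEN App_V])
  then have "sat W (star \<circ> e) \<phi>" by (simp only: sat_star)
  then have "\<forall>x\<in>st A. \<exists>y\<in>st A. star u = star_fun2 V W star A A f y x"
    by (simp add: e_def \<phi>_def f[THEN App_W] f[THEN star_fun2_closed] star_set_def[symmetric])
  then show ?thesis using x by metis
qed

text \<open>Separate additions on \<open>A\<close> and \<open>C\<close> cover distributivity in a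
  ring as well as (a + b) x = a x + b x in a module.\<close>

lemma star_fun2_distr_right:
  assumes f: "op_on A B C f" "op_on A A A f'" "op_on C C C f''"
    and V: "\<And>x y z. x \<in> A \<Longrightarrow> y \<in> A \<Longrightarrow> z \<in> B \<Longrightarrow> f (f' x y) z = f'' (f x z) (f y z)"
    and xyz: "x \<in> st A" "y \<in> st A" "z \<in> st B"
  shows "star_fun2 V W star A B f (star_fun2 V W star A A f' x y) z =
    star_fun2 V W star C C f'' (star_fun2 V W star A B f x z) (star_fun2 V W star A B f y z)"
proof -
  note [simp] = f[THEN op_onD(1), THEN elts_code_k] f[THEN op_onD(2), THEN elts_code_k]
    f[THEN op_onD(3), THEN elts_code_k]
  define e where "e = (\<lambda>_::nat. code V A)(7 := code V B, 8 := code V C,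
    12 := graph2 V A B f, 13 := graph2 V A A f', 14 := graph2 V C C f'')"
  define \<phi> where "\<phi> = BAll 20 6 (BAll 21 6 (BAll 22 7 (BEx 23 6 (Conj (App_fm 13 20 21 23)
    (BEx 24 8 (Conj (App_fm 12 20 22 24) (BEx 25 8 (Conj (App_fm 12 21 22 25)
    (BEx 26 8 (Conj (App_fm 12 23 22 26) (App_fm 14 24 25 26)))))))))))"
  have "sat V e \<phi>"
    using f[THEN op_onD(4)] V by (simp add: e_def \<phi>_def f[THEN App_V])
  then have "sat W (star \<circ> e) \<phi>" by (simp only: sat_star)
  then show ?thesis
    using xyz by (simp add: e_def \<phi>_def f[THEN App_W] f[THEN star_fun2_closed] star_set_def[symmetric])
qed

lemma star_fun2_distr_left:
  assumes f: "op_on A B C f" "op_on B B B f'" "op_on C C C f''"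
    and V: "\<And>x y z. x \<in> A \<Longrightarrow> y \<in> B \<Longrightarrow> z \<in> B \<Longrightarrow> f x (f' y z) = f'' (f x y) (f x z)"
    and xyz: "x \<in> st A" "y \<in> st B" "z \<in> st B"
  shows "star_fun2 V W star A B f x (star_fun2 V W star B B f' y z) =
    star_fun2 V W star C C f'' (star_fun2 V W star A B f x y) (star_fun2 V W star A B f x z)"
proof -
  note [simp] = f[THEN op_onD(1), THEN elts_code_k] f[THEN op_onD(2), THEN elts_code_k]
    f[THEN op_onD(3), THEN elts_code_k]
  define e where "e = (\<lambda>_::nat. code V A)(7 := code V B, 8 := code V C,
    12 := graph2 V A B f, 13 := graph2 V B B f', 14 := graph2 V C C f'')"
  define \<phi> where "\<phi> = BAll 20 6 (BAll 21 7 (BAll 22 7 (BEx 23 7 (Conj (App_fm 13 21 22 23)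
    (BEx 24 8 (Conj (App_fm 12 20 21 24) (BEx 25 8 (Conj (App_fm 12 20 22 25)
    (BEx 26 8 (Conj (App_fm 12 20 23 26) (App_fm 14 24 25 26)))))))))))"
  have "sat V e \<phi>"
    using f[THEN op_onD(4)] V by (simp add: e_def \<phi>_def f[THEN App_V])
  then have "sat W (star \<circ> e) \<phi>" by (simp only: sat_star)
  then show ?thesis
    using xyz by (simp add: e_def \<phi>_def f[THEN App_W] f[THEN star_fun2_closed] star_set_def[symmetric])
qed

end

section \<open>Linear combinations\<close>

text \<open>A family \<open>\<sigma>\<close> indexed by \<open>S\<close> is used, rather than a set
  of vectors, so that the same finite set indexes generators in M, with the identity as family, and
  their images in *M, with \<open>star\<close> as family.\<close>

definition combos ::
  "('r, 'c) ring_scheme \<Rightarrow> ('r, 'm, 'd) module_scheme \<Rightarrow> ('s \<Rightarrow> 'm) \<Rightarrow> 's set \<Rightarrow> 'm set" where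
  "combos R M \<sigma> S = {\<Oplus>\<^bsub>M\<^esub>s\<in>S. c s \<odot>\<^bsub>M\<^esub> \<sigma> s | c. c \<in> S \<rightarrow> carrier R}"

context module
begin

lemma submodule_zero: "submodule H R M \<Longrightarrow> \<zero>\<^bsub>M\<^esub> \<in> H"
  using subgroup.one_closed[OF submodule.axioms(1)] by force

lemma combos_empty [simp]: "combos R M \<sigma> {} = {\<zero>\<^bsub>M\<^esub>}"
  by (auto simp: combos_def)

text \<open>This form of the span has just two existential choices, \<open>y\<close> and
  \<open>r\<close>, whatever the size of \<open>S\<close>, and can thus be expressed by one bounded
  formula.\<close>

lemma combos_insert:
  assumes "finite S" "g \<notin> S" "\<sigma> \<in> insert g S \<rightarrow> carrier M"
  shows "combos R M \<sigma> (insert g S) =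
    {y \<oplus>\<^bsub>M\<^esub> r \<odot>\<^bsub>M\<^esub> \<sigma> g | y r. y \<in> combos R M \<sigma> S \<and> r \<in> carrier R}" (is "?L = ?R")
proof -
  have *: "(\<Oplus>\<^bsub>M\<^esub>s\<in>insert g S. c s \<odot>\<^bsub>M\<^esub> \<sigma> s) = (\<Oplus>\<^bsub>M\<^esub>s\<in>S. c s \<odot>\<^bsub>M\<^esub> \<sigma> s) \<oplus>\<^bsub>M\<^esub> c g \<odot>\<^bsub>M\<^esub> \<sigma> g"
    if "c \<in> insert g S \<rightarrow> carrier R" for c
    using assms that by (subst M.finsum_insert) (auto simp: Pi_iff intro!: M.a_comm M.finsum_closed)
  show ?thesis
  proof (intro equalityI subsetI)
    fix x assume "x \<in> ?L"
    then obtain c where "c \<in> insert g S \<rightarrow> carrier R" "x = (\<Oplus>\<^bsub>M\<^esub>s\<in>insert g S. c s \<odot>\<^bsub>M\<^esub> \<sigma> s)"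
      by (auto simp: combos_def)
    with * show "x \<in> ?R" by (fastforce simp: combos_def)
  next
    fix x assume "x \<in> ?R"
    then obtain c r where c: "c \<in> S \<rightarrow> carrier R" "r \<in> carrier R"
      and x: "x = (\<Oplus>\<^bsub>M\<^esub>s\<in>S. c s \<odot>\<^bsub>M\<^esub> \<sigma> s) \<oplus>\<^bsub>M\<^esub> r \<odot>\<^bsub>M\<^esub> \<sigma> g"
      by (auto simp: combos_def)
    define c' where "c' = c(g := r)"
    have c': "c' \<in> insert g S \<rightarrow> carrier R" using c by (auto simp: c'_def)
    have "(\<Oplus>\<^bsub>M\<^esub>s\<in>S. c s \<odot>\<^bsub>M\<^esub> \<sigma> s) = (\<Oplus>\<^bsub>M\<^esub>s\<in>S. c' s \<odot>\<^bsub>M\<^esub> \<sigma> s)"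
      using assms c by (intro M.finsum_cong') (auto simp: c'_def Pi_iff)
    then have "x = (\<Oplus>\<^bsub>M\<^esub>s\<in>insert g S. c' s \<odot>\<^bsub>M\<^esub> \<sigma> s)"
      using x *[OF c'] by (simp add: c'_def)
    with c' show "x \<in> ?L" by (auto simp: combos_def)
  qed
qed

lemma combos_subset: "\<sigma> \<in> S \<rightarrow> carrier M \<Longrightarrow> combos R M \<sigma> S \<subseteq> carrier M"
  by (auto simp: combos_def intro!: M.finsum_closed)

lemma submodule_combos:
  assumes S: "finite S" and \<sigma>: "\<sigma> \<in> S \<rightarrow> carrier M"
  shows "submodule (combos R M \<sigma> S) R M"
proof -
  have smult: "a \<odot>\<^bsub>M\<^esub> x \<in> combos R M \<sigma> S" if a: "a \<in> carrier R" and x: "x \<in> combos R M \<sigma> S" for a x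
  proof -
    from x obtain c where c: "c \<in> S \<rightarrow> carrier R" and x: "x = (\<Oplus>\<^bsub>M\<^esub>s\<in>S. c s \<odot>\<^bsub>M\<^esub> \<sigma> s)"
      by (auto simp: combos_def)
    have "a \<odot>\<^bsub>M\<^esub> x = (\<Oplus>\<^bsub>M\<^esub>s\<in>S. a \<odot>\<^bsub>M\<^esub> (c s \<odot>\<^bsub>M\<^esub> \<sigma> s))"
      unfolding x using S a c \<sigma> by (intro finsum_smult_ldistr) auto
    also have "\<dots> = (\<Oplus>\<^bsub>M\<^esub>s\<in>S. (a \<otimes> c s) \<odot>\<^bsub>M\<^esub> \<sigma> s)"
      using a c \<sigma> by (intro M.finsum_cong') (auto simp: smult_assoc1 Pi_iff)
    finally show ?thesis using a c by (auto simp: combos_def intro!: exI[of _ "\<lambda>s. a \<otimes> c s"])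
  qed
  have sub: "combos R M \<sigma> S \<subseteq> carrier M" using \<sigma> by (rule combos_subset)
  show ?thesis
  proof (rule submoduleI)
    have "(\<Oplus>\<^bsub>M\<^esub>s\<in>S. \<zero> \<odot>\<^bsub>M\<^esub> \<sigma> s) = (\<Oplus>\<^bsub>M\<^esub>s\<in>S. \<zero>\<^bsub>M\<^esub>)"
      using \<sigma> by (intro M.finsum_cong') (auto simp: Pi_iff)
    then show "\<zero>\<^bsub>M\<^esub> \<in> combos R M \<sigma> S"
      by (auto simp: combos_def intro!: exI[of _ "\<lambda>_. \<zero>"])
    show "\<ominus>\<^bsub>M\<^esub> a \<in> combos R M \<sigma> S" if "a \<in> combos R M \<sigma> S" for a
      using smult[of "\<ominus> \<one>" a] that sub by (auto simp: smult_l_minus)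
    fix a b assume "a \<in> combos R M \<sigma> S" "b \<in> combos R M \<sigma> S"
    then obtain c d where c: "c \<in> S \<rightarrow> carrier R" "d \<in> S \<rightarrow> carrier R"
      and ab: "a = (\<Oplus>\<^bsub>M\<^esub>s\<in>S. c s \<odot>\<^bsub>M\<^esub> \<sigma> s)" "b = (\<Oplus>\<^bsub>M\<^esub>s\<in>S. d s \<odot>\<^bsub>M\<^esub> \<sigma> s)"
      by (auto simp: combos_def)
    have "a \<oplus>\<^bsub>M\<^esub> b = (\<Oplus>\<^bsub>M\<^esub>s\<in>S. c s \<odot>\<^bsub>M\<^esub> \<sigma> s \<oplus>\<^bsub>M\<^esub> d s \<odot>\<^bsub>M\<^esub> \<sigma> s)"
      unfolding ab using c \<sigma> by (intro M.finsum_addf[symmetric]) auto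
    also have "\<dots> = (\<Oplus>\<^bsub>M\<^esub>s\<in>S. (c s \<oplus> d s) \<odot>\<^bsub>M\<^esub> \<sigma> s)"
      using c \<sigma> by (intro M.finsum_cong') (auto simp: smult_l_distr Pi_iff)
    finally show "a \<oplus>\<^bsub>M\<^esub> b \<in> combos R M \<sigma> S"
      using c by (auto simp: combos_def intro!: exI[of _ "\<lambda>s. c s \<oplus> d s"])
  qed (use sub smult in auto)
qed

text \<open>Zero lies in the span of the remaining generators, so \<open>combos_insert\<close> with
  coefficient 1 yields the generator; no sum with Kronecker coefficients has to be
  evaluated.\<close>

lemma combos_memI:
  assumes "finite S" "\<sigma> \<in> S \<rightarrow> carrier M" "s \<in> S"
  shows "\<sigma> s \<in> combos R M \<sigma> S"
proof -
  have S: "insert s (S - {s}) = S" using assms by auto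
  have "\<zero>\<^bsub>M\<^esub> \<in> combos R M \<sigma> (S - {s})"
    using assms by (intro submodule_zero submodule_combos) auto
  moreover have "combos R M \<sigma> (insert s (S - {s})) =
      {y \<oplus>\<^bsub>M\<^esub> r \<odot>\<^bsub>M\<^esub> \<sigma> s | y r. y \<in> combos R M \<sigma> (S - {s}) \<and> r \<in> carrier R}"
    using assms by (intro combos_insert) auto
  ultimately have "\<zero>\<^bsub>M\<^esub> \<oplus>\<^bsub>M\<^esub> \<one> \<odot>\<^bsub>M\<^esub> \<sigma> s \<in> combos R M \<sigma> (insert s (S - {s}))"
    using R.one_closed by blast
  moreover have "\<zero>\<^bsub>M\<^esub> \<oplus>\<^bsub>M\<^esub> \<one> \<odot>\<^bsub>M\<^esub> \<sigma> s = \<sigma> s"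
    using assms by (simp add: Pi_iff)
  ultimately show ?thesis by (simp only: S)
qed

end

section \<open>Finitely generated ideals as spans\<close>

lemma ring_as_module_simps [simp]:
  "carrier (ring_as_module R) = carrier R" "add (ring_as_module R) = add R"
  "zero (ring_as_module R) = zero R" "smult (ring_as_module R) = mult R"
  by (simp_all add: ring_as_module_def)

lemma finsum_ring_as_module [simp]: "finsum (ring_as_module R) f A = finsum R f A"
  by (simp add: finsum_def finprod_def)

lemma a_inv_ring_as_module [simp]: "a_inv (ring_as_module R) x = a_inv R x"
  by (simp add: a_inv_def m_inv_def)

lemma (in cring) module_ring_as_module: "module R (ring_as_module R)"
proof (rule moduleI)
  show "abelian_group (ring_as_module R)"
    by (rule abelian_groupI) (auto simp: a_assoc intro: a_comm l_neg)
qed (auto simp: m_assoc l_distr r_distr is_cring)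

text \<open>A Noetherian ring supplies generators in the sense of \<open>genideal\<close>, whereas
  spans are what can be enlarged. One inclusion is minimality of \<open>Idl A\<close>, once the span
  is seen to be an ideal.\<close>

lemma (in cring) Idl_eq_combos:
  assumes "finite A" "A \<subseteq> carrier R"
  shows "Idl A = combos R (ring_as_module R) (\<lambda>a. a) A" (is "_ = ?C")
proof
  interpret Rm: module R "ring_as_module R" by (rule module_ring_as_module)
  have sub: "submodule ?C R (ring_as_module R)"
    using assms by (intro Rm.submodule_combos) auto
  have "ideal ?C R"
  proof (rule idealI)
    show "subgroup ?C (add_monoid R)"
      using Rm.submoduleE[OF sub] by (intro add.subgroupI) (auto simp: a_inv_def[symmetric])
    fix a x assume "a \<in> ?C" "x \<in> carrier R"
    then show "x \<otimes> a \<in> ?C" using Rm.submoduleE(4)[OF sub] by simp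
    then show "a \<otimes> x \<in> ?C" using Rm.submoduleE(1)[OF sub] \<open>a \<in> ?C\<close> \<open>x \<in> carrier R\<close> m_comm by auto
  qed (rule ring_axioms)
  moreover have "A \<subseteq> ?C" using assms Rm.combos_memI[of A "\<lambda>a. a"] by auto
  ultimately show "Idl A \<subseteq> ?C" by (rule genideal_minimal)
  interpret I: ideal "Idl A" R using assms by (intro genideal_ideal)
  \<comment> \<open>\<open>Idl A\<close> is kept fixed while the subset \<open>B\<close> grows, so
    each new generator is already known to lie in it.\<close>
  have "combos R (ring_as_module R) (\<lambda>a. a) B \<subseteq> Idl A" if "finite B" "B \<subseteq> A" for B
    using that
  proof (induction B)
    case (insert b B)
    have "b \<in> Idl A" using insert.prems genideal_self[OF assms(2)] by auto
    then show ?case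
      using insert assms Rm.combos_insert[of B b "\<lambda>a. a"] by (auto simp: Pi_iff subset_eq I.I_l_closed)
  qed auto
  then show "?C \<subseteq> Idl A" using assms by blast
qed

section \<open>Enlargements of rings and modules\<close>

context star_map
begin

text \<open>Base case for enlarging spans: the empty span {0} acquires no new points, because being
  equal to a parameter is a bounded statement.\<close>

lemma star_singleton:
  assumes "a \<in> level V k"
  shows "st {a} = {star a}"
proof -
  define e where "e = (\<lambda>_::nat. a)(7 := code V {a})"
  have "sat V e (BAll 10 7 (Eql 10 6))"
    using assms by (simp add: e_def elts_code_k)
  then have "sat W (star \<circ> e) (BAll 10 7 (Eql 10 6))" by (simp only: sat_star)
  then have "\<forall>x\<in>st {a}. x = star a" by (simp add: e_def star_set_def)
  moreover have "star a \<in> st {a}" using assms by (simp add: star_mem_iff)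
  ultimately show ?thesis by blast
qed

text \<open>The span of \<open>insert g S\<close> is \<open>N' = N + R g\<close> if \<open>N\<close> is the span of \<open>S\<close>. Enlarging
  this equation, one generator at a time, is all that is needed to enlarge spans.\<close>

lemma star_sum_span:
  assumes f: "op_on A G G f" "op_on G G G f'" and g: "g \<in> G" and N: "N \<subseteq> G" "N' \<subseteq> G"
    and V: "N' = {f' y (f r g) | y r. y \<in> N \<and> r \<in> A}"
  shows "st N' = {star_fun2 V W star G G f' y (star_fun2 V W star A G f r (star g)) | y r.
    y \<in> st N \<and> r \<in> st A}" (is "_ = ?R")
proof -
  have Nk: "N \<subseteq> level V k" "N' \<subseteq> level V k" using N op_onD(2)[OF f(1)] by auto
  note [simp] = op_onD(1-2)[OF f(1), THEN elts_code_k] Nk[THEN elts_code_k]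
  define e where "e = (\<lambda>_::nat. code V A)(7 := code V G, 8 := code V N, 9 := code V N',
    10 := g, 12 := graph2 V A G f, 13 := graph2 V G G f')"
  define \<phi> where "\<phi> = BAll 20 9 (BEx 21 8 (BEx 22 6 (BEx 23 7 (Conj (App_fm 12 22 10 23) (App_fm 13 21 23 20)))))"
  define \<psi> where "\<psi> = BAll 21 8 (BAll 22 6 (BEx 23 7 (Conj (App_fm 12 22 10 23) (BEx 20 9 (App_fm 13 21 23 20)))))"
  \<comment> \<open>Expresses that \<open>N\<close> is contained in \<open>G\<close>, with
    membership written as equality to some element so that it evaluates to \<open>elts\<close>. Its
    transfer places *N in the domain of the enlarged addition, as \<open>App_W\<close>
    requires.\<close>
  define \<chi> where "\<chi> = BAll 20 8 (BEx 21 7 (Eql 21 20))"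
  have mem: "y \<in> N \<Longrightarrow> y \<in> G" for y using N by auto
  have "sat V e \<chi>" using N by (simp add: e_def \<chi>_def subset_eq)
  have "\<forall>x\<in>N'. \<exists>y\<in>N. \<exists>r\<in>A. x = f' y (f r g)" using V by auto
  then have "sat V e \<phi>"
    using g f[THEN op_onD(4)] mem by (simp add: e_def \<phi>_def f[THEN App_V])
  moreover have "\<forall>y\<in>N. \<forall>r\<in>A. f' y (f r g) \<in> N'" using V by auto
  then have "sat V e \<psi>"
    using g f[THEN op_onD(4)] mem by (simp add: e_def \<psi>_def f[THEN App_V])
  ultimately have W: "sat W (star \<circ> e) \<phi>" "sat W (star \<circ> e) \<psi>" "sat W (star \<circ> e) \<chi>"
    using \<open>sat V e \<chi>\<close> by (simp_all only: sat_star)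
  have sg: "star g \<in> st G" using g star_mem_iff op_onD(2)[OF f(1)] by simp
  have mem: "y \<in> st N \<Longrightarrow> y \<in> st G" for y
    using W(3) by (simp add: e_def \<chi>_def star_set_def)
  note simps = e_def f[THEN App_W] f[THEN star_fun2_closed] star_set_def[symmetric] mem sg
  show ?thesis
  proof (intro equalityI subsetI)
    fix x assume "x \<in> st N'"
    then show "x \<in> ?R"
      using W(1) by (fastforce simp: \<phi>_def simps)
  next
    fix x assume "x \<in> ?R"
    then obtain y r where "y \<in> st N" "r \<in> st A"
      "x = star_fun2 V W star G G f' y (star_fun2 V W star A G f r (star g))" by auto
    then show "x \<in> st N'"
      using W(2) by (auto simp: \<psi>_def simps)
  qed
qed

text \<open>Transfer treats \<open>N\<close> and \<open>I\<close> as mere sets, so \<open>r\<close>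
  is placed in *I before any generators are considered. These come in separately, by
  \<open>star_combos\<close> for *N and by \<open>star_Idl\<close> for *I.\<close>

lemma star_colon:
  assumes f: "op_on A G G f" and g: "g \<in> G" and N: "N \<subseteq> G" and I: "I \<subseteq> A"
    and V: "\<And>r. r \<in> A \<Longrightarrow> f r g \<in> N \<Longrightarrow> r \<in> I"
    and r: "r \<in> st A" "star_fun2 V W star A G f r (star g) \<in> st N"
  shows "r \<in> st I"
proof -
  have Nk: "N \<subseteq> level V k" "I \<subseteq> level V k" using N I op_onD(1,2)[OF f] by auto
  note [simp] = op_onD(1-2)[OF f, THEN elts_code_k] Nk[THEN elts_code_k]
  define e where "e = (\<lambda>_::nat. code V A)(7 := code V G, 8 := code V N, 9 := code V I,
    10 := g, 12 := graph2 V A G f)"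
  define \<phi> where "\<phi> = BAll 20 6 (BEx 21 7 (Conj (App_fm 12 20 10 21)
    (Imp (BEx 22 8 (Eql 22 21)) (BEx 22 9 (Eql 22 20)))))"
  have "sat V e \<phi>"
    using V g f[THEN op_onD(4)] by (simp add: e_def \<phi>_def f[THEN App_V])
  then have "sat W (star \<circ> e) \<phi>" by (simp only: sat_star)
  moreover have "star g \<in> st G" using g star_mem_iff op_onD(2)[OF f(1)] by simp
  ultimately show ?thesis
    using r by (auto simp: e_def \<phi>_def f[THEN App_W] star_set_def[symmetric])
qed

end

section \<open>Enlarged groups, rings and modules\<close>

context star_map
begin

lemma op_on_add:
  assumes "abelian_group G" "carrier G \<subseteq> level V k"
  shows "op_on (carrier G) (carrier G) (carrier G) (add G)"
  using assms abelian_groupE(1) by (auto simp: op_on_def)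

text \<open>\<open>H\<close> is any record with the enlarged carrier, zero and addition, so that the
  lemma serves both \<open>star_ring\<close> and \<open>star_module\<close>, which have different
  record types.\<close>

lemma abelian_group_star:
  fixes G :: "('v, 'g) ring_scheme" and H :: "('w, 'h) ring_scheme"
  assumes G: "abelian_group G" "carrier G \<subseteq> level V k"
    and H: "carrier H = st (carrier G)" "zero H = star (zero G)"
      "add H = star_fun2 V W star (carrier G) (carrier G) (add G)"
  shows "abelian_group H"
proof -
  interpret G: abelian_group G by (rule G)
  note op = op_on_add[OF G]
  show ?thesis
  proof (rule abelian_groupI)
    fix x y z assume "x \<in> carrier H" "y \<in> carrier H" "z \<in> carrier H"
    then show "x \<oplus>\<^bsub>H\<^esub> y \<in> carrier H" "x \<oplus>\<^bsub>H\<^esub> y = y \<oplus>\<^bsub>H\<^esub> x"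
      "x \<oplus>\<^bsub>H\<^esub> y \<oplus>\<^bsub>H\<^esub> z = x \<oplus>\<^bsub>H\<^esub> (y \<oplus>\<^bsub>H\<^esub> z)"
      using star_fun2_closed[OF op] star_fun2_comm[where f = "add G", OF op G.a_comm]
        star_fun2_assoc[where f = "add G" and f' = "add G" and f'' = "add G" and f''' = "add G",
            OF op op op op G.a_assoc]
      by (simp_all add: H)
  next
    show "\<zero>\<^bsub>H\<^esub> \<in> carrier H" using G by (simp add: H star_mem_iff)
    fix x assume x: "x \<in> carrier H"
    then show "\<zero>\<^bsub>H\<^esub> \<oplus>\<^bsub>H\<^esub> x = x"
      using star_fun2_unit[OF op G.zero_closed G.l_zero] by (simp add: H)
    have "\<exists>y\<in>carrier G. y \<oplus>\<^bsub>G\<^esub> x = \<zero>\<^bsub>G\<^esub>" if "x \<in> carrier G" for x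
      using that G.l_neg[of x] G.a_inv_closed[of x] by blast
    then show "\<exists>y\<in>carrier H. y \<oplus>\<^bsub>H\<^esub> x = \<zero>\<^bsub>H\<^esub>"
      using star_fun2_inverse[OF op] x by (simp add: H)
  qed
qed

end

locale star_module_map =
  star_map h V W star k + module R M
  for h :: enat and V :: "'v universe" and W :: "'w universe" and star :: "'v \<Rightarrow> 'w" and k :: nat
    and R :: "('v, 'c) ring_scheme" (structure) and M :: "('v, 'v, 'd) module_scheme" (structure) +
  assumes RV: "carrier R \<subseteq> level V k" and MV: "carrier M \<subseteq> level V k"
begin

abbreviation sR :: "'w ring" where "sR \<equiv> star_ring V W star R"
abbreviation sM :: "('w, 'w) module" where "sM \<equiv> star_module V W star R M"

lemma op_ons:
  "op_on (carrier R) (carrier R) (carrier R) (add R)" "op_on (carrier R) (carrier R) (carrier R) (mult R)"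
  "op_on (carrier M) (carrier M) (carrier M) (add M)" "op_on (carrier R) (carrier M) (carrier M) (smult M)"
  using RV MV by (auto simp: op_on_def)

lemma star_ring_simps [simp]:
  "carrier sR = st (carrier R)" "one sR = star (one R)" "zero sR = star (zero R)"
  "add sR = star_fun2 V W star (carrier R) (carrier R) (add R)"
  "mult sR = star_fun2 V W star (carrier R) (carrier R) (mult R)"
  by (simp_all add: star_ring_def)

lemma star_module_simps [simp]:
  "carrier sM = st (carrier M)" "zero sM = star (zero M)"
  "add sM = star_fun2 V W star (carrier M) (carrier M) (add M)"
  "smult sM = star_fun2 V W star (carrier R) (carrier M) (smult M)"
  by (simp_all add: star_module_def)

lemma cring_star_ring: "cring sR"
proof (rule cringI)
  show "abelian_group sR"
    by (rule abelian_group_star[of R]) (simp_all add: RV R.abelian_group_axioms)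
  show "comm_monoid sR"
  proof (rule comm_monoidI)
    fix x y z assume "x \<in> carrier sR" "y \<in> carrier sR" "z \<in> carrier sR"
    then show "x \<otimes>\<^bsub>sR\<^esub> y \<in> carrier sR" "x \<otimes>\<^bsub>sR\<^esub> y = y \<otimes>\<^bsub>sR\<^esub> x"
      "x \<otimes>\<^bsub>sR\<^esub> y \<otimes>\<^bsub>sR\<^esub> z = x \<otimes>\<^bsub>sR\<^esub> (y \<otimes>\<^bsub>sR\<^esub> z)"
      using star_fun2_closed[OF op_ons(2)] star_fun2_comm[where f = "mult R", OF op_ons(2) R.m_comm]
        star_fun2_assoc[where f = "mult R" and f' = "mult R" and f'' = "mult R" and f''' = "mult R",
            OF op_ons(2) op_ons(2) op_ons(2) op_ons(2) R.m_assoc]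
      by simp_all
  next
    show "\<one>\<^bsub>sR\<^esub> \<in> carrier sR" by (simp add: star_mem_iff RV)
    show "\<one>\<^bsub>sR\<^esub> \<otimes>\<^bsub>sR\<^esub> x = x" if "x \<in> carrier sR" for x
      using star_fun2_unit[OF op_ons(2) R.one_closed R.l_one] that by simp
  qed
  show "(x \<oplus>\<^bsub>sR\<^esub> y) \<otimes>\<^bsub>sR\<^esub> z = x \<otimes>\<^bsub>sR\<^esub> z \<oplus>\<^bsub>sR\<^esub> y \<otimes>\<^bsub>sR\<^esub> z"
    if "x \<in> carrier sR" "y \<in> carrier sR" "z \<in> carrier sR" for x y z
    using star_fun2_distr_right[where f = "mult R" and f' = "add R" and f'' = "add R",
        OF op_ons(2) op_ons(1) op_ons(1) R.l_distr] that by simp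
qed

lemma module_star_module: "module sR sM"
proof (rule moduleI)
  show "cring sR" by (rule cring_star_ring)
  show "abelian_group sM"
    by (rule abelian_group_star[of M]) (simp_all add: MV M.abelian_group_axioms)
  fix a b x y assume "a \<in> carrier sR" "b \<in> carrier sR" "x \<in> carrier sM" "y \<in> carrier sM"
  then show "a \<odot>\<^bsub>sM\<^esub> x \<in> carrier sM"
    "(a \<oplus>\<^bsub>sR\<^esub> b) \<odot>\<^bsub>sM\<^esub> x = a \<odot>\<^bsub>sM\<^esub> x \<oplus>\<^bsub>sM\<^esub> b \<odot>\<^bsub>sM\<^esub> x"
    "a \<odot>\<^bsub>sM\<^esub> (x \<oplus>\<^bsub>sM\<^esub> y) = a \<odot>\<^bsub>sM\<^esub> x \<oplus>\<^bsub>sM\<^esub> a \<odot>\<^bsub>sM\<^esub> y"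
    "(a \<otimes>\<^bsub>sR\<^esub> b) \<odot>\<^bsub>sM\<^esub> x = a \<odot>\<^bsub>sM\<^esub> (b \<odot>\<^bsub>sM\<^esub> x)"
    using star_fun2_closed[OF op_ons(4)]
      star_fun2_distr_right[where f = "smult M" and f' = "add R" and f'' = "add M",
        OF op_ons(4) op_ons(1) op_ons(3) smult_l_distr]
      star_fun2_distr_left[where f = "smult M" and f' = "add M" and f'' = "add M",
        OF op_ons(4) op_ons(3) op_ons(3) smult_r_distr]
      star_fun2_assoc[where f = "smult M" and f' = "mult R" and f'' = "smult M" and f''' = "smult M",
        OF op_ons(4) op_ons(2) op_ons(4) op_ons(4) smult_assoc1]
    by simp_all
next
  show "\<one>\<^bsub>sR\<^esub> \<odot>\<^bsub>sM\<^esub> x = x" if "x \<in> carrier sM" for x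
    using star_fun2_unit[OF op_ons(4) R.one_closed smult_one] that by simp
qed

lemma star_ring_hom: "star \<in> ring_hom R sR"
  by (rule ring_hom_memI) (simp_all add: star_mem_iff RV star_fun2_star[OF op_ons(1)] star_fun2_star[OF op_ons(2)])

lemma star_closed: "x \<in> carrier M \<Longrightarrow> star x \<in> carrier sM"
  by (simp add: star_mem_iff MV)

lemma star_add: "x \<in> carrier M \<Longrightarrow> y \<in> carrier M \<Longrightarrow> star (x \<oplus>\<^bsub>M\<^esub> y) = star x \<oplus>\<^bsub>sM\<^esub> star y"
  by (simp add: star_fun2_star[OF op_ons(3)])

lemma star_smult: "r \<in> carrier R \<Longrightarrow> x \<in> carrier M \<Longrightarrow> star (r \<odot>\<^bsub>M\<^esub> x) = star r \<odot>\<^bsub>sM\<^esub> star x"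
  by (simp add: star_fun2_star[OF op_ons(4)])

text \<open>\<open>S\<close> is a finite set of HOL, and the induction takes place outside the
  universes; each step is one application of \<open>star_sum_span\<close>. On the right the
  coefficients range over all of *R while the generators stay standard.\<close>

lemma star_combos:
  assumes "finite S" "S \<subseteq> carrier M"
  shows "st (combos R M (\<lambda>s. s) S) = combos sR sM star S"
  using assms
proof (induction S)
  interpret sM: module sR sM by (rule module_star_module)
  case empty
  show ?case using sM.combos_empty[of star] MV by (simp add: star_singleton subset_eq)
next
  interpret sM: module sR sM by (rule module_star_module)
  case (insert g S)
  then have g: "g \<in> carrier M" and S: "S \<subseteq> carrier M" by auto
  have N: "combos R M (\<lambda>s. s) S \<subseteq> carrier M" "combos R M (\<lambda>s. s) (insert g S) \<subseteq> carrier M"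
    using insert.prems by (intro combos_subset; force)+
  have "combos R M (\<lambda>s. s) (insert g S) =
      {y \<oplus>\<^bsub>M\<^esub> r \<odot>\<^bsub>M\<^esub> g | y r. y \<in> combos R M (\<lambda>s. s) S \<and> r \<in> carrier R}"
    using insert.hyps insert.prems by (intro combos_insert) auto
  note star_sum_span[OF op_ons(4) op_ons(3) g N this]
  moreover have "combos sR sM star (insert g S) =
      {y \<oplus>\<^bsub>sM\<^esub> r \<odot>\<^bsub>sM\<^esub> star g | y r. y \<in> combos sR sM star S \<and> r \<in> carrier sR}"
    using insert.hyps insert.prems star_closed by (intro sM.combos_insert) auto
  ultimately show ?case using insert.IH[OF S] by simp
qed

text \<open>Makes \<open>star_combos\<close> available for ideals, viewed as submodules of
  \<open>R\<close>.\<close>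

lemma star_module_ring: "star_module_map h V W star k R (ring_as_module R)"
  by (intro star_module_map.intro star_map_axioms R.module_ring_as_module star_module_map_axioms.intro)
    (simp_all add: RV)

text \<open>The two records may differ in \<open>mult\<close> and \<open>one\<close>, but they agree
  in carrier, zero, addition and scalar multiplication, from which linear combinations are
  formed.\<close>

lemma combos_star_ring:
  "combos sR (star_module V W star R (ring_as_module R)) \<sigma> A = combos sR (ring_as_module sR) \<sigma> A"
proof -
  have "finsum (star_module V W star R (ring_as_module R)) f A = finsum sR f A" for f
    by (simp add: finsum_def finprod_def star_module_def star_ring_def)
  then show ?thesis by (simp add: combos_def star_module_def)
qed

text \<open>Finite generation is what makes the ideal a span to which \<open>star_combos\<close>
  applies.\<close>

lemma star_Idl:
  assumes "finite A" "A \<subseteq> carrier R"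
  shows "st (Idl A) = combos sR (ring_as_module sR) star A"
  using star_module_map.star_combos[OF star_module_ring] assms
  by (simp add: R.Idl_eq_combos combos_star_ring)

text \<open>Provides the condition \<open>colon\<close> of the locale \<open>base_change\<close>.
  Transfer of the description of the ideal puts \<open>t\<close> into its enlargement, and the
  finitely many generators turn this into coefficients from *R; flatness of *R need not be
  established first.\<close>

lemma smult_mem_combos_star:
  assumes S: "finite S" "S \<subseteq> carrier M" and g: "g \<in> carrier M"
    and A: "finite A" "A \<subseteq> carrier R" "Idl A = {a \<in> carrier R. a \<odot>\<^bsub>M\<^esub> g \<in> combos R M (\<lambda>s. s) S}"
    and t: "t \<in> carrier sR" "t \<odot>\<^bsub>sM\<^esub> star g \<in> combos sR sM star S"
  shows "t \<in> combos sR (ring_as_module sR) star A"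
proof -
  have N: "combos R M (\<lambda>s. s) S \<subseteq> carrier M"
    using S by (intro combos_subset) auto
  have "t \<in> st (Idl A)"
    by (rule star_colon[OF op_ons(4) g N]) (use A t star_combos[OF S] in auto)
  then show ?thesis using star_Idl[OF A(1,2)] by simp
qed

end

section \<open>Tensor products\<close>

lemma module_homsI:
  assumes "h \<in> extensional (carrier M)" "\<And>x. x \<in> carrier M \<Longrightarrow> h x \<in> carrier N"
    "\<And>x y. x \<in> carrier M \<Longrightarrow> y \<in> carrier M \<Longrightarrow> h (x \<oplus>\<^bsub>M\<^esub> y) = h x \<oplus>\<^bsub>N\<^esub> h y"
    "\<And>r x. r \<in> carrier R \<Longrightarrow> x \<in> carrier M \<Longrightarrow> h (r \<odot>\<^bsub>M\<^esub> x) = r \<odot>\<^bsub>N\<^esub> h x"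
  shows "h \<in> module_homs R M N"
  using assms by (auto simp: module_homs_def PiE_def)

lemma module_homsD:
  assumes "h \<in> module_homs R M N"
  shows "h \<in> extensional (carrier M)" "x \<in> carrier M \<Longrightarrow> h x \<in> carrier N"
    "x \<in> carrier M \<Longrightarrow> y \<in> carrier M \<Longrightarrow> h (x \<oplus>\<^bsub>M\<^esub> y) = h x \<oplus>\<^bsub>N\<^esub> h y"
    "r \<in> carrier R \<Longrightarrow> x \<in> carrier M \<Longrightarrow> h (r \<odot>\<^bsub>M\<^esub> x) = r \<odot>\<^bsub>N\<^esub> h x"
  using assms by (auto simp: module_homs_def PiE_def Pi_iff)

context
  fixes R :: "('r, 'c) ring_scheme" and M :: "('r, 'm, 'd) module_scheme"
    and N :: "('r, 'n, 'e) module_scheme" and h :: "'m \<Rightarrow> 'n"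
  assumes M: "module R M" and N: "module R N" and h: "h \<in> module_homs R M N"
begin

lemma module_hom_zero: "h \<zero>\<^bsub>M\<^esub> = \<zero>\<^bsub>N\<^esub>"
proof -
  interpret M: module R M by (rule M)
  interpret N: module R N by (rule N)
  have "h (\<zero>\<^bsub>R\<^esub> \<odot>\<^bsub>M\<^esub> \<zero>\<^bsub>M\<^esub>) = \<zero>\<^bsub>R\<^esub> \<odot>\<^bsub>N\<^esub> h \<zero>\<^bsub>M\<^esub>"
    using module_homsD(4)[OF h] by blast
  then show ?thesis using module_homsD(2)[OF h] by simp
qed

lemma module_hom_minus:
  assumes "x \<in> carrier M" "y \<in> carrier M"
  shows "h (x \<ominus>\<^bsub>M\<^esub> y) = h x \<ominus>\<^bsub>N\<^esub> h y"
proof -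
  interpret M: module R M by (rule M)
  interpret N: module R N by (rule N)
  have "h (\<ominus>\<^bsub>M\<^esub> y) = h ((\<ominus>\<^bsub>R\<^esub> \<one>\<^bsub>R\<^esub>) \<odot>\<^bsub>M\<^esub> y)"
    using assms by (simp add: M.smult_l_minus)
  also have "\<dots> = \<ominus>\<^bsub>N\<^esub> h y"
    using assms module_homsD(2,4)[OF h] by (simp add: N.smult_l_minus)
  finally show ?thesis using assms module_homsD(3)[OF h] by (simp add: a_minus_def)
qed

lemma module_hom_finsum:
  assumes "finite A" "f \<in> A \<rightarrow> carrier M"
  shows "h (\<Oplus>\<^bsub>M\<^esub>a\<in>A. f a) = (\<Oplus>\<^bsub>N\<^esub>a\<in>A. h (f a))"
proof -
  interpret M: module R M by (rule M)
  interpret N: module R N by (rule N)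
  show ?thesis
    using assms
  proof (induction A)
    case empty
    show ?case using module_hom_zero by simp
  next
    case (insert a A)
    then show ?case
      using module_homsD(2,3)[OF h] by (simp add: Pi_iff)
  qed
qed

end

lemma module_isosI:
  assumes M: "module R M" and N: "module R N" and h: "h \<in> module_homs R M N"
    and inj: "\<And>x. x \<in> carrier M \<Longrightarrow> h x = \<zero>\<^bsub>N\<^esub> \<Longrightarrow> x = \<zero>\<^bsub>M\<^esub>"
    and surj: "\<And>y. y \<in> carrier N \<Longrightarrow> \<exists>x\<in>carrier M. h x = y"
  shows "h \<in> module_isos R M N"
proof -
  interpret M: module R M by (rule M)
  interpret N: module R N by (rule N)
  have "inj_on h (carrier M)"
  proof (rule inj_onI)
    fix x y assume xy: "x \<in> carrier M" "y \<in> carrier M" "h x = h y"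
    then have "h (x \<ominus>\<^bsub>M\<^esub> y) = \<zero>\<^bsub>N\<^esub>"
      using module_hom_minus[OF M N h] module_homsD(2)[OF h] by (simp add: N.M.r_neg a_minus_def)
    then have "x \<ominus>\<^bsub>M\<^esub> y = \<zero>\<^bsub>M\<^esub>" using inj xy by simp
    moreover have "x = (x \<ominus>\<^bsub>M\<^esub> y) \<oplus>\<^bsub>M\<^esub> y"
      using xy by (simp add: a_minus_def M.M.a_assoc M.M.l_neg)
    ultimately show "x = y" using xy by simp
  qed
  moreover have "h ` carrier M = carrier N"
    using surj module_homsD(2)[OF h] by blast
  ultimately show ?thesis using h by (simp add: module_isos_def bij_betw_def)
qed

lemma module_restrict_scalars:
  assumes R: "cring R" and \<phi>: "\<phi> \<in> ring_hom R S" and N: "module S N"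
  shows "module R (restrict_scalars \<phi> N)"
proof -
  interpret N: module S N by (rule N)
  show ?thesis
  proof (rule moduleI)
    show "abelian_group (restrict_scalars \<phi> N)"
      by (rule abelian_groupI)
        (auto simp: restrict_scalars_def N.M.a_assoc intro: N.M.a_comm N.M.l_neg)
  qed (use R ring_hom_closed[OF \<phi>] ring_hom_add[OF \<phi>] ring_hom_mult[OF \<phi>] ring_hom_one[OF \<phi>] in
    \<open>simp_all add: restrict_scalars_def N.smult_l_distr N.smult_r_distr N.smult_assoc1\<close>)
qed

lemma restrict_scalars_simps [simp]:
  "carrier (restrict_scalars \<phi> N) = carrier N" "add (restrict_scalars \<phi> N) = add N"
  "zero (restrict_scalars \<phi> N) = zero N" "smult (restrict_scalars \<phi> N) r x = \<phi> r \<odot>\<^bsub>N\<^esub> x"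
  by (simp_all add: restrict_scalars_def)

lemma finsum_restrict_scalars [simp]: "finsum (restrict_scalars \<phi> N) f A = finsum N f A"
  by (simp add: finsum_def finprod_def)

section \<open>Quotient modules\<close>

context module
begin

lemma abelian_subgroup_submodule:
  assumes "submodule K R M"
  shows "abelian_subgroup K M"
  using assms by (intro abelian_subgroupI3 additive_subgroupI M.abelian_group_axioms) (rule submodule.axioms(1))

context
  fixes K assumes K: "submodule K R M"
begin

lemma quotient_module_simps [simp]:
  "zero (quotient_module M K) = K" "add (quotient_module M K) = set_add M"
  by (simp_all add: quotient_module_def)

lemma carrier_quotient_module: "carrier (quotient_module M K) = (\<lambda>x. K +>\<^bsub>M\<^esub> x) ` carrier M"
  by (auto simp: quotient_module_def A_RCOSETS_def')

lemma add_rcosets: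
  "x \<in> carrier M \<Longrightarrow> y \<in> carrier M \<Longrightarrow>
    (K +>\<^bsub>M\<^esub> x) \<oplus>\<^bsub>quotient_module M K\<^esub> (K +>\<^bsub>M\<^esub> y) = K +>\<^bsub>M\<^esub> (x \<oplus>\<^bsub>M\<^esub> y)"
  using abelian_subgroup.a_rcos_sum[OF abelian_subgroup_submodule[OF K]] by simp

lemma rcoset_eqI:
  assumes "x \<in> carrier M" "y \<in> carrier M" "x \<ominus>\<^bsub>M\<^esub> y \<in> K"
  shows "K +>\<^bsub>M\<^esub> x = K +>\<^bsub>M\<^esub> y"
proof -
  interpret K: abelian_subgroup K M by (rule abelian_subgroup_submodule[OF K])
  have "x \<in> K +>\<^bsub>M\<^esub> y"
    using assms by (simp add: K.a_rcos_module a_minus_def)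
  then show ?thesis using K.a_repr_independence' assms by simp
qed

text \<open>Scalar multiplication on the quotient is a union over all representatives. It collapses
  because all its members are the same coset and there is at least one representative.\<close>

lemma smult_rcosets:
  assumes "r \<in> carrier R" "x \<in> carrier M"
  shows "r \<odot>\<^bsub>quotient_module M K\<^esub> (K +>\<^bsub>M\<^esub> x) = K +>\<^bsub>M\<^esub> (r \<odot>\<^bsub>M\<^esub> x)"
proof -
  interpret K: abelian_subgroup K M by (rule abelian_subgroup_submodule[OF K])
  have "K +>\<^bsub>M\<^esub> (r \<odot>\<^bsub>M\<^esub> x') = K +>\<^bsub>M\<^esub> (r \<odot>\<^bsub>M\<^esub> x)" if x': "x' \<in> K +>\<^bsub>M\<^esub> x" for x'
  proof -
    obtain n where n: "n \<in> K" "x' = n \<oplus>\<^bsub>M\<^esub> x" using x' by (auto simp: a_r_coset_def')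
    have nc: "n \<in> carrier M" using n K.a_subset by auto
    have "r \<odot>\<^bsub>M\<^esub> x' \<ominus>\<^bsub>M\<^esub> r \<odot>\<^bsub>M\<^esub> x = r \<odot>\<^bsub>M\<^esub> n"
      using assms nc by (simp add: n smult_r_distr a_minus_def M.a_assoc M.r_neg)
    also have "\<dots> \<in> K" using submodule.smult_closed[OF K] assms n by simp
    finally show ?thesis using assms n nc by (intro rcoset_eqI) auto
  qed
  moreover have "x \<in> K +>\<^bsub>M\<^esub> x" using assms K.a_rcos_self by simp
  ultimately have "(\<Union>x'\<in>K +>\<^bsub>M\<^esub> x. K +>\<^bsub>M\<^esub> (r \<odot>\<^bsub>M\<^esub> x')) = K +>\<^bsub>M\<^esub> (r \<odot>\<^bsub>M\<^esub> x)"
    by blast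
  then show ?thesis by (simp add: quotient_module_def)
qed

lemma module_quotient_module: "module R (quotient_module M K)"
proof -
  interpret K: abelian_subgroup K M by (rule abelian_subgroup_submodule[OF K])
  have K0: "K +>\<^bsub>M\<^esub> \<zero>\<^bsub>M\<^esub> = K" using K.a_subset by simp
  let ?Q = "quotient_module M K"
  note simps = carrier_quotient_module add_rcosets smult_rcosets
  show ?thesis
  proof (rule moduleI)
    show "abelian_group ?Q"
    proof (rule abelian_groupI)
      show "\<zero>\<^bsub>?Q\<^esub> \<in> carrier ?Q" using K0 by (auto simp: carrier_quotient_module)
      fix x assume "x \<in> carrier ?Q"
      then obtain a where a: "a \<in> carrier M" "x = K +>\<^bsub>M\<^esub> a" by (auto simp: carrier_quotient_module)
      show "\<zero>\<^bsub>?Q\<^esub> \<oplus>\<^bsub>?Q\<^esub> x = x" using add_rcosets[of "\<zero>\<^bsub>M\<^esub>" a] a K0 by simp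
      show "\<exists>y\<in>carrier ?Q. y \<oplus>\<^bsub>?Q\<^esub> x = \<zero>\<^bsub>?Q\<^esub>"
        using add_rcosets[of "\<ominus>\<^bsub>M\<^esub> a" a] a K0 by (auto simp: carrier_quotient_module M.l_neg)
    qed (auto simp: carrier_quotient_module add_rcosets M.a_ac simp del: quotient_module_simps)
  qed (auto simp: simps smult_l_distr smult_r_distr smult_assoc1 R.is_cring simp del: quotient_module_simps)
qed

end

end

section \<open>Free modules and their universal property\<close>

lemma free_module_simps [simp]:
  "zero (free_module R B) = (\<lambda>_. \<zero>\<^bsub>R\<^esub>)" "(f \<oplus>\<^bsub>free_module R B\<^esub> g) b = f b \<oplus>\<^bsub>R\<^esub> g b"
  "(r \<odot>\<^bsub>free_module R B\<^esub> f) b = r \<otimes>\<^bsub>R\<^esub> f b"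
  by (simp_all add: free_module_def)

lemma carrier_free_module:
  "f \<in> carrier (free_module R B) \<longleftrightarrow>
    (\<forall>b\<in>B. f b \<in> carrier R) \<and> (\<forall>b. b \<notin> B \<longrightarrow> f b = \<zero>\<^bsub>R\<^esub>) \<and> finite {b. f b \<noteq> \<zero>\<^bsub>R\<^esub>}"
  by (simp add: free_module_def)

context cring
begin

lemma free_module_closed: "f \<in> carrier (free_module R B) \<Longrightarrow> f b \<in> carrier R"
  by (cases "b \<in> B") (auto simp: carrier_free_module)

lemma finite_supp: "f \<in> carrier (free_module R B) \<Longrightarrow> finite {b. f b \<noteq> \<zero>}"
  by (simp add: carrier_free_module)

lemma free_module_add_closed:
  assumes "f \<in> carrier (free_module R B)" "g \<in> carrier (free_module R B)"
  shows "f \<oplus>\<^bsub>free_module R B\<^esub> g \<in> carrier (free_module R B)"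
proof -
  have "{b. f b \<oplus> g b \<noteq> \<zero>} \<subseteq> {b. f b \<noteq> \<zero>} \<union> {b. g b \<noteq> \<zero>}" by auto
  then have "finite {b. f b \<oplus> g b \<noteq> \<zero>}"
    using finite_supp[OF assms(1)] finite_supp[OF assms(2)] by (meson finite_UnI finite_subset)
  then show ?thesis using assms by (simp add: carrier_free_module)
qed

lemma free_module_smult_closed:
  assumes "r \<in> carrier R" "g \<in> carrier (free_module R B)"
  shows "r \<odot>\<^bsub>free_module R B\<^esub> g \<in> carrier (free_module R B)"
proof -
  have "{b. r \<otimes> g b \<noteq> \<zero>} \<subseteq> {b. g b \<noteq> \<zero>}" using assms by auto
  then have "finite {b. r \<otimes> g b \<noteq> \<zero>}"
    using finite_supp[OF assms(2)] by (meson finite_subset)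
  then show ?thesis using assms by (simp add: carrier_free_module)
qed

lemma module_free_module: "module R (free_module R B)"
proof (rule moduleI)
  show "abelian_group (free_module R B)"
  proof (rule abelian_groupI)
    fix f assume f: "f \<in> carrier (free_module R B)"
    show "\<exists>g\<in>carrier (free_module R B). g \<oplus>\<^bsub>free_module R B\<^esub> f = \<zero>\<^bsub>free_module R B\<^esub>"
      using free_module_smult_closed[of "\<ominus> \<one>" f B] f free_module_closed[OF f]
      by (intro bexI[of _ "\<ominus> \<one> \<odot>\<^bsub>free_module R B\<^esub> f"] ext) (auto simp: l_minus l_neg)
  qed (auto intro!: ext simp: free_module_closed free_module_add_closed a_ac,
      auto simp: carrier_free_module)
qed (auto intro!: ext simp: is_cring free_module_closed free_module_smult_closed l_distr r_distr m_assoc)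

lemma basis_elt_closed: "b \<in> B \<Longrightarrow> basis_elt R b \<in> carrier (free_module R B)"
  by (auto simp: carrier_free_module basis_elt_def)

text \<open>Coordinates of the finite support are split off one by one. The basis case carries the
  scalar, so no closure of \<open>P\<close> under scalars is asked for; with tensors the scalar is
  absorbed into a pure tensor.\<close>

lemma free_module_induct [consumes 1, case_names zero add basis]:
  assumes f: "f \<in> carrier (free_module R B)"
    and zero: "P (\<lambda>_. \<zero>)"
    and add: "\<And>f g. f \<in> carrier (free_module R B) \<Longrightarrow> g \<in> carrier (free_module R B) \<Longrightarrow> P f \<Longrightarrow> P g \<Longrightarrow>
      P (f \<oplus>\<^bsub>free_module R B\<^esub> g)"
    and basis: "\<And>r b. r \<in> carrier R \<Longrightarrow> b \<in> B \<Longrightarrow> P (r \<odot>\<^bsub>free_module R B\<^esub> basis_elt R b)"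
  shows "P f"
proof -
  \<comment> \<open>\<open>T\<close> contains the support but may leave \<open>B\<close>. This
    allows plain induction on finite sets, at the price of the easy case
    \<open>b \<notin> B\<close>.\<close>
  have "P f" if "finite T" "f \<in> carrier (free_module R B)" "{b. f b \<noteq> \<zero>} \<subseteq> T" for T f
    using that
  proof (induction T arbitrary: f)
    case empty
    then have "f = (\<lambda>_. \<zero>)" by auto
    with zero show ?case by simp
  next
    case (insert b T)
    show ?case
    proof (cases "b \<in> B")
      case False
      then have "{b. f b \<noteq> \<zero>} \<subseteq> T" using insert.prems by (auto simp: carrier_free_module)
      then show ?thesis using insert by blast
    next
      case True
      define g where "g = f(b := \<zero>)"
      have sub: "{b. g b \<noteq> \<zero>} \<subseteq> T" using insert.prems by (auto simp: g_def)
      then have g: "g \<in> carrier (free_module R B)"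
        using insert.prems(1) finite_subset[OF sub insert.hyps(1)] True
        by (auto simp: carrier_free_module g_def)
      have fb: "f b \<in> carrier R" using insert.prems(1) by (rule free_module_closed)
      have "f = g \<oplus>\<^bsub>free_module R B\<^esub> (f b \<odot>\<^bsub>free_module R B\<^esub> basis_elt R b)"
        using free_module_closed[OF insert.prems(1)] by (auto intro!: ext simp: g_def basis_elt_def)
      moreover have "P (g \<oplus>\<^bsub>free_module R B\<^esub> (f b \<odot>\<^bsub>free_module R B\<^esub> basis_elt R b))"
        using insert.IH[OF g sub] basis[OF fb True] g fb basis_elt_closed[OF True]
        by (intro add free_module_smult_closed) auto
      ultimately show ?thesis by simp
    qed
  qed
  then show ?thesis using f finite_supp by blast
qed

lemma free_module_hom_ex:
  assumes P: "module R P" and \<beta>: "\<beta> \<in> B \<rightarrow> carrier P"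
  obtains \<Phi> where "\<Phi> \<in> module_homs R (free_module R B) P" "\<And>b. b \<in> B \<Longrightarrow> \<Phi> (basis_elt R b) = \<beta> b"
proof -
  interpret P: module R P by (rule P)
  let ?F = "free_module R B"
  define \<Phi>0 where "\<Phi>0 f = (\<Oplus>\<^bsub>P\<^esub>b\<in>{b. f b \<noteq> \<zero>}. f b \<odot>\<^bsub>P\<^esub> \<beta> b)" for f
  define \<Phi> where "\<Phi> = restrict \<Phi>0 (carrier ?F)"
  have supp: "{b. f b \<noteq> \<zero>} \<subseteq> B" if "f \<in> carrier ?F" for f
    using that by (auto simp: carrier_free_module)
  have term_closed: "f b \<odot>\<^bsub>P\<^esub> \<beta> b \<in> carrier P" if "f \<in> carrier ?F" "b \<in> B" for f b
    using that \<beta> free_module_closed[OF that(1)] by auto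
  \<comment> \<open>Addition and scalar multiplication can change the support. Summing over any
    finite \<open>T\<close> that contains the support makes such sums comparable.\<close>
  have eq: "\<Phi>0 f = (\<Oplus>\<^bsub>P\<^esub>b\<in>T. f b \<odot>\<^bsub>P\<^esub> \<beta> b)"
    if "f \<in> carrier ?F" "finite T" "{b. f b \<noteq> \<zero>} \<subseteq> T" "T \<subseteq> B" for f T
    unfolding \<Phi>0_def using that \<beta> term_closed[OF that(1)]
    by (intro P.M.add.finprod_mono_neutral_cong_left) (auto simp: Pi_iff)
  have "\<Phi> \<in> module_homs R ?F P"
  proof (rule module_homsI)
    show "\<Phi> \<in> extensional (carrier ?F)" by (simp add: \<Phi>_def)
    show "\<Phi> f \<in> carrier P" if "f \<in> carrier ?F" for f
      using that term_closed[OF that] supp[OF that]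
      by (auto simp: \<Phi>_def \<Phi>0_def intro!: P.M.finsum_closed)
    fix f assume f: "f \<in> carrier ?F"
    show "\<Phi> (f \<oplus>\<^bsub>?F\<^esub> g) = \<Phi> f \<oplus>\<^bsub>P\<^esub> \<Phi> g" if g: "g \<in> carrier ?F" for g
    proof -
      define T where "T = {b. f b \<noteq> \<zero>} \<union> {b. g b \<noteq> \<zero>}"
      have T: "finite T" "T \<subseteq> B" using finite_supp supp f g by (auto simp: T_def)
      have "\<Phi>0 (f \<oplus>\<^bsub>?F\<^esub> g) = (\<Oplus>\<^bsub>P\<^esub>b\<in>T. (f b \<oplus> g b) \<odot>\<^bsub>P\<^esub> \<beta> b)"
        using free_module_add_closed[OF f g] T by (subst eq[of _ T]) (auto simp: T_def)
      also have "\<dots> = (\<Oplus>\<^bsub>P\<^esub>b\<in>T. f b \<odot>\<^bsub>P\<^esub> \<beta> b \<oplus>\<^bsub>P\<^esub> g b \<odot>\<^bsub>P\<^esub> \<beta> b)"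
        using T \<beta> term_closed f g free_module_closed[OF f] free_module_closed[OF g]
        by (intro P.M.finsum_cong') (auto simp: P.smult_l_distr subset_eq Pi_iff)
      also have "\<dots> = (\<Oplus>\<^bsub>P\<^esub>b\<in>T. f b \<odot>\<^bsub>P\<^esub> \<beta> b) \<oplus>\<^bsub>P\<^esub> (\<Oplus>\<^bsub>P\<^esub>b\<in>T. g b \<odot>\<^bsub>P\<^esub> \<beta> b)"
        using T term_closed f g by (intro P.M.finsum_addf) (auto simp: subset_eq)
      also have "\<dots> = \<Phi>0 f \<oplus>\<^bsub>P\<^esub> \<Phi>0 g"
        using T f g by (simp add: eq[of _ T] T_def)
      finally show ?thesis using f g free_module_add_closed[OF f g] by (simp add: \<Phi>_def)
    qed
    show "\<Phi> (r \<odot>\<^bsub>?F\<^esub> f) = r \<odot>\<^bsub>P\<^esub> \<Phi> f" if r: "r \<in> carrier R" for r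
    proof -
      define T where "T = {b. f b \<noteq> \<zero>}"
      have T: "finite T" "T \<subseteq> B" using finite_supp supp f by (auto simp: T_def)
      have "\<Phi>0 (r \<odot>\<^bsub>?F\<^esub> f) = (\<Oplus>\<^bsub>P\<^esub>b\<in>T. (r \<otimes> f b) \<odot>\<^bsub>P\<^esub> \<beta> b)"
        using free_module_smult_closed[OF r f] T r by (subst eq[of _ T]) (auto simp: T_def)
      also have "\<dots> = (\<Oplus>\<^bsub>P\<^esub>b\<in>T. r \<odot>\<^bsub>P\<^esub> (f b \<odot>\<^bsub>P\<^esub> \<beta> b))"
        using T \<beta> r f free_module_closed[OF f] term_closed
        by (intro P.M.finsum_cong') (auto simp: P.smult_assoc1 subset_eq Pi_iff)
      also have "\<dots> = r \<odot>\<^bsub>P\<^esub> \<Phi>0 f"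
        unfolding \<Phi>0_def T_def[symmetric] using T r f term_closed
        by (intro P.finsum_smult_ldistr[symmetric]) (auto simp: subset_eq)
      finally show ?thesis using f free_module_smult_closed[OF r f] by (simp add: \<Phi>_def)
    qed
  qed
  moreover have "\<Phi> (basis_elt R b) = \<beta> b" if b: "b \<in> B" for b
  proof -
    have "\<Phi>0 (basis_elt R b) = (\<Oplus>\<^bsub>P\<^esub>b'\<in>{b}. basis_elt R b b' \<odot>\<^bsub>P\<^esub> \<beta> b')"
      using b basis_elt_closed[OF b] by (intro eq) (auto simp: basis_elt_def)
    also have "\<dots> = \<beta> b"
      using b \<beta> by (subst P.M.finsum_insert) (auto simp: basis_elt_def Pi_iff)
    finally show ?thesis using basis_elt_closed[OF b] by (simp add: \<Phi>_def)
  qed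
  ultimately show thesis by (rule that)
qed

end

section \<open>The tensor product and its universal property\<close>

locale tensor = M: module R M + N: module R N
  for R :: "('r, 'c) ring_scheme" and M :: "('r, 'm, 'd) module_scheme" and N :: "('r, 'n, 'e) module_scheme"
begin

abbreviation F :: "('r, 'm \<times> 'n \<Rightarrow> 'r) module" where "F \<equiv> free_module R (carrier M \<times> carrier N)"
abbreviation K :: "('m \<times> 'n \<Rightarrow> 'r) set" where "K \<equiv> tensor_submodule R M N"
abbreviation T :: "('r, ('m \<times> 'n \<Rightarrow> 'r) set) module" where "T \<equiv> tensor_product R M N"
abbreviation e :: "'m \<Rightarrow> 'n \<Rightarrow> 'm \<times> 'n \<Rightarrow> 'r" where "e m n \<equiv> basis_elt R (m, n)"
abbreviation ten :: "'m \<Rightarrow> 'n \<Rightarrow> ('m \<times> 'n \<Rightarrow> 'r) set" where "ten \<equiv> pure_tensor R M N"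

lemma module_F: "module R F"
  by (rule M.R.module_free_module)

sublocale F: module R F by (rule module_F)

lemma e_closed: "m \<in> carrier M \<Longrightarrow> n \<in> carrier N \<Longrightarrow> e m n \<in> carrier F"
  by (rule M.R.basis_elt_closed) simp

lemma tensor_relationsI:
  "\<lbrakk>m \<in> carrier M; m' \<in> carrier M; n \<in> carrier N\<rbrakk> \<Longrightarrow>
    e (m \<oplus>\<^bsub>M\<^esub> m') n \<ominus>\<^bsub>F\<^esub> (e m n \<oplus>\<^bsub>F\<^esub> e m' n) \<in> tensor_relations R M N"
  "\<lbrakk>m \<in> carrier M; n \<in> carrier N; n' \<in> carrier N\<rbrakk> \<Longrightarrow>
    e m (n \<oplus>\<^bsub>N\<^esub> n') \<ominus>\<^bsub>F\<^esub> (e m n \<oplus>\<^bsub>F\<^esub> e m n') \<in> tensor_relations R M N"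
  "\<lbrakk>r \<in> carrier R; m \<in> carrier M; n \<in> carrier N\<rbrakk> \<Longrightarrow>
    e (r \<odot>\<^bsub>M\<^esub> m) n \<ominus>\<^bsub>F\<^esub> r \<odot>\<^bsub>F\<^esub> e m n \<in> tensor_relations R M N"
  "\<lbrakk>r \<in> carrier R; m \<in> carrier M; n \<in> carrier N\<rbrakk> \<Longrightarrow>
    e m (r \<odot>\<^bsub>N\<^esub> n) \<ominus>\<^bsub>F\<^esub> r \<odot>\<^bsub>F\<^esub> e m n \<in> tensor_relations R M N"
  unfolding tensor_relations_def Let_def by blast+

lemma tensor_relations_cases:
  assumes "x \<in> tensor_relations R M N"
  obtains
    m m' n where "m \<in> carrier M" "m' \<in> carrier M" "n \<in> carrier N"
      "x = e (m \<oplus>\<^bsub>M\<^esub> m') n \<ominus>\<^bsub>F\<^esub> (e m n \<oplus>\<^bsub>F\<^esub> e m' n)"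
  | m n n' where "m \<in> carrier M" "n \<in> carrier N" "n' \<in> carrier N"
      "x = e m (n \<oplus>\<^bsub>N\<^esub> n') \<ominus>\<^bsub>F\<^esub> (e m n \<oplus>\<^bsub>F\<^esub> e m n')"
  | r m n where "r \<in> carrier R" "m \<in> carrier M" "n \<in> carrier N"
      "x = e (r \<odot>\<^bsub>M\<^esub> m) n \<ominus>\<^bsub>F\<^esub> r \<odot>\<^bsub>F\<^esub> e m n"
  | r m n where "r \<in> carrier R" "m \<in> carrier M" "n \<in> carrier N"
      "x = e m (r \<odot>\<^bsub>N\<^esub> n) \<ominus>\<^bsub>F\<^esub> r \<odot>\<^bsub>F\<^esub> e m n"
  using assms unfolding tensor_relations_def Let_def
proof (elim UnE CollectE exE conjE)
qed (rule that(1) that(2) that(3) that(4); assumption)+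

lemma tensor_relations_subset: "tensor_relations R M N \<subseteq> carrier F"
proof
  fix x assume "x \<in> tensor_relations R M N"
  then show "x \<in> carrier F"
    by (cases rule: tensor_relations_cases) (auto intro!: F.M.minus_closed F.M.a_closed F.smult_closed e_closed)
qed

lemma submodule_K: "submodule K R F"
proof -
  define \<N> where "\<N> = {N'. submodule N' R F \<and> tensor_relations R M N \<subseteq> N'}"
  have K: "K = \<Inter>\<N>" by (simp add: tensor_submodule_def submodule_generated_def \<N>_def)
  \<comment> \<open>One member is needed to keep the intersection inside \<open>carrier F\<close>,
    since the empty intersection is \<open>UNIV\<close>.\<close>
  have "carrier F \<in> \<N>" using tensor_relations_subset F.carrier_is_submodule by (simp add: \<N>_def)
  then show ?thesis
    unfolding K using F.submoduleE F.submodule_zero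
    by (intro F.submoduleI) (auto simp: \<N>_def)
qed

lemma relations_K: "tensor_relations R M N \<subseteq> K"
  by (auto simp: tensor_submodule_def submodule_generated_def)

lemma K_minimal: "submodule N' R F \<Longrightarrow> tensor_relations R M N \<subseteq> N' \<Longrightarrow> K \<subseteq> N'"
  by (auto simp: tensor_submodule_def submodule_generated_def)

lemma module_T: "module R T"
  unfolding tensor_product_def by (rule F.module_quotient_module[OF submodule_K])

sublocale T: module R T by (rule module_T)

lemma carrier_T: "carrier T = (\<lambda>x. K +>\<^bsub>F\<^esub> x) ` carrier F"
  unfolding tensor_product_def by (rule F.carrier_quotient_module[OF submodule_K])

lemma zero_T: "\<zero>\<^bsub>T\<^esub> = K +>\<^bsub>F\<^esub> \<zero>\<^bsub>F\<^esub>"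
  using F.submoduleE(1)[OF submodule_K] F.M.a_coset_add_zero by (simp add: tensor_product_def quotient_module_def)

lemma add_T: "x \<in> carrier F \<Longrightarrow> y \<in> carrier F \<Longrightarrow> K +>\<^bsub>F\<^esub> (x \<oplus>\<^bsub>F\<^esub> y) = (K +>\<^bsub>F\<^esub> x) \<oplus>\<^bsub>T\<^esub> (K +>\<^bsub>F\<^esub> y)"
  unfolding tensor_product_def by (rule F.add_rcosets[OF submodule_K, symmetric])

lemma smult_T: "r \<in> carrier R \<Longrightarrow> x \<in> carrier F \<Longrightarrow> K +>\<^bsub>F\<^esub> (r \<odot>\<^bsub>F\<^esub> x) = r \<odot>\<^bsub>T\<^esub> (K +>\<^bsub>F\<^esub> x)"
  unfolding tensor_product_def by (rule F.smult_rcosets[OF submodule_K, symmetric])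

lemma coset_eqI:
  "x \<in> carrier F \<Longrightarrow> y \<in> carrier F \<Longrightarrow> x \<ominus>\<^bsub>F\<^esub> y \<in> tensor_relations R M N \<Longrightarrow> K +>\<^bsub>F\<^esub> x = K +>\<^bsub>F\<^esub> y"
  using relations_K by (intro F.rcoset_eqI[OF submodule_K]) auto

lemma ten_closed: "m \<in> carrier M \<Longrightarrow> n \<in> carrier N \<Longrightarrow> ten m n \<in> carrier T"
  by (auto simp: pure_tensor_def carrier_T e_closed)

lemma ten_add_left:
  assumes "m \<in> carrier M" "m' \<in> carrier M" "n \<in> carrier N"
  shows "ten (m \<oplus>\<^bsub>M\<^esub> m') n = ten m n \<oplus>\<^bsub>T\<^esub> ten m' n"
  unfolding pure_tensor_def
  by (subst add_T[symmetric])
    (rule assms coset_eqI tensor_relationsI e_closed F.M.a_closed F.smult_closed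
      M.M.a_closed M.smult_closed N.M.a_closed N.smult_closed)+

lemma ten_add_right:
  assumes "m \<in> carrier M" "n \<in> carrier N" "n' \<in> carrier N"
  shows "ten m (n \<oplus>\<^bsub>N\<^esub> n') = ten m n \<oplus>\<^bsub>T\<^esub> ten m n'"
  unfolding pure_tensor_def
  by (subst add_T[symmetric])
    (rule assms coset_eqI tensor_relationsI e_closed F.M.a_closed F.smult_closed
      M.M.a_closed M.smult_closed N.M.a_closed N.smult_closed)+

lemma ten_smult_left:
  assumes "r \<in> carrier R" "m \<in> carrier M" "n \<in> carrier N"
  shows "ten (r \<odot>\<^bsub>M\<^esub> m) n = r \<odot>\<^bsub>T\<^esub> ten m n"
  unfolding pure_tensor_def
  by (subst smult_T[symmetric])
    (rule assms coset_eqI tensor_relationsI e_closed F.M.a_closed F.smult_closed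
      M.M.a_closed M.smult_closed N.M.a_closed N.smult_closed)+

lemma ten_smult_right:
  assumes "r \<in> carrier R" "m \<in> carrier M" "n \<in> carrier N"
  shows "ten m (r \<odot>\<^bsub>N\<^esub> n) = r \<odot>\<^bsub>T\<^esub> ten m n"
  unfolding pure_tensor_def
  by (subst smult_T[symmetric])
    (rule assms coset_eqI tensor_relationsI e_closed F.M.a_closed F.smult_closed
      M.M.a_closed M.smult_closed N.M.a_closed N.smult_closed)+

lemma ten_hom_left: "n \<in> carrier N \<Longrightarrow> (\<lambda>m\<in>carrier M. ten m n) \<in> module_homs R M T"
  by (rule module_homsI) (auto simp: ten_closed ten_add_left ten_smult_left)

lemma ten_hom_right: "m \<in> carrier M \<Longrightarrow> (\<lambda>n\<in>carrier N. ten m n) \<in> module_homs R N T"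
  by (rule module_homsI) (auto simp: ten_closed ten_add_right ten_smult_right)

lemma ten_finsum_left:
  assumes "finite A" "f \<in> A \<rightarrow> carrier M" "n \<in> carrier N"
  shows "ten (\<Oplus>\<^bsub>M\<^esub>a\<in>A. f a) n = (\<Oplus>\<^bsub>T\<^esub>a\<in>A. ten (f a) n)"
proof -
  have "ten (\<Oplus>\<^bsub>M\<^esub>a\<in>A. f a) n = (\<Oplus>\<^bsub>T\<^esub>a\<in>A. (\<lambda>m\<in>carrier M. ten m n) (f a))"
    using module_hom_finsum[OF M.module_axioms module_T ten_hom_left[OF assms(3)] assms(1,2)] assms(2)
    by (simp add: M.M.finsum_closed)
  also have "\<dots> = (\<Oplus>\<^bsub>T\<^esub>a\<in>A. ten (f a) n)"
    using assms ten_closed by (intro T.M.finsum_cong') auto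
  finally show ?thesis .
qed

lemma ten_finsum_right:
  assumes "finite A" "f \<in> A \<rightarrow> carrier N" "m \<in> carrier M"
  shows "ten m (\<Oplus>\<^bsub>N\<^esub>a\<in>A. f a) = (\<Oplus>\<^bsub>T\<^esub>a\<in>A. ten m (f a))"
proof -
  have "ten m (\<Oplus>\<^bsub>N\<^esub>a\<in>A. f a) = (\<Oplus>\<^bsub>T\<^esub>a\<in>A. (\<lambda>n\<in>carrier N. ten m n) (f a))"
    using module_hom_finsum[OF N.module_axioms module_T ten_hom_right[OF assms(3)] assms(1,2)] assms(2)
    by (simp add: N.M.finsum_closed)
  also have "\<dots> = (\<Oplus>\<^bsub>T\<^esub>a\<in>A. ten m (f a))"
    using assms ten_closed by (intro T.M.finsum_cong') auto
  finally show ?thesis .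
qed

text \<open>Scalars need no case of their own, because r (m \<otimes> n) = (r m) \<otimes> n is
  again a pure tensor.\<close>

lemma tensor_induct [consumes 1, case_names zero add ten]:
  assumes x: "x \<in> carrier T"
    and zero: "P \<zero>\<^bsub>T\<^esub>"
    and add: "\<And>x y. x \<in> carrier T \<Longrightarrow> y \<in> carrier T \<Longrightarrow> P x \<Longrightarrow> P y \<Longrightarrow> P (x \<oplus>\<^bsub>T\<^esub> y)"
    and ten: "\<And>m n. m \<in> carrier M \<Longrightarrow> n \<in> carrier N \<Longrightarrow> P (ten m n)"
  shows "P x"
proof -
  obtain f where f: "f \<in> carrier F" and x: "x = K +>\<^bsub>F\<^esub> f" using x by (auto simp: carrier_T)
  have "P (K +>\<^bsub>F\<^esub> f)"
    using f
  proof (induction f rule: M.R.free_module_induct)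
    case zero
    show ?case using assms(2) zero_T by simp
  next
    case (add f g)
    then show ?case by (auto simp: add_T carrier_T simp del: free_module_simps intro!: assms(3))
  next
    case (basis r b)
    then obtain m n where b: "b = (m, n)" "m \<in> carrier M" "n \<in> carrier N" by auto
    have "K +>\<^bsub>F\<^esub> (r \<odot>\<^bsub>F\<^esub> basis_elt R b) = ten (r \<odot>\<^bsub>M\<^esub> m) n"
      using basis b by (simp add: smult_T e_closed ten_smult_left) (simp add: pure_tensor_def)
    then show ?case using ten basis b by (simp del: free_module_simps)
  qed
  then show ?thesis by (simp add: x)
qed

text \<open>The extension of \<open>\<beta>\<close> to the free module kills the four kinds of
  relations, hence the submodule \<open>K\<close> generated by them, and so is constant on
  cosets.\<close>

lemma tensor_hom_ex:
  assumes P: "module R P"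
    and closed: "\<And>m n. m \<in> carrier M \<Longrightarrow> n \<in> carrier N \<Longrightarrow> \<beta> m n \<in> carrier P"
    and add_left: "\<And>m m' n. m \<in> carrier M \<Longrightarrow> m' \<in> carrier M \<Longrightarrow> n \<in> carrier N \<Longrightarrow>
      \<beta> (m \<oplus>\<^bsub>M\<^esub> m') n = \<beta> m n \<oplus>\<^bsub>P\<^esub> \<beta> m' n"
    and add_right: "\<And>m n n'. m \<in> carrier M \<Longrightarrow> n \<in> carrier N \<Longrightarrow> n' \<in> carrier N \<Longrightarrow>
      \<beta> m (n \<oplus>\<^bsub>N\<^esub> n') = \<beta> m n \<oplus>\<^bsub>P\<^esub> \<beta> m n'"
    and smult_left: "\<And>r m n. r \<in> carrier R \<Longrightarrow> m \<in> carrier M \<Longrightarrow> n \<in> carrier N \<Longrightarrow>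
      \<beta> (r \<odot>\<^bsub>M\<^esub> m) n = r \<odot>\<^bsub>P\<^esub> \<beta> m n"
    and smult_right: "\<And>r m n. r \<in> carrier R \<Longrightarrow> m \<in> carrier M \<Longrightarrow> n \<in> carrier N \<Longrightarrow>
      \<beta> m (r \<odot>\<^bsub>N\<^esub> n) = r \<odot>\<^bsub>P\<^esub> \<beta> m n"
  shows "\<exists>h. h \<in> module_homs R T P \<and> (\<forall>m\<in>carrier M. \<forall>n\<in>carrier N. h (ten m n) = \<beta> m n)"
proof -
  interpret P: module R P by (rule P)
  have "case_prod \<beta> \<in> carrier M \<times> carrier N \<rightarrow> carrier P" using closed by auto
  from M.R.free_module_hom_ex[OF P this]
  obtain \<Phi> where \<Phi>: "\<Phi> \<in> module_homs R F P"
    and "\<And>b. b \<in> carrier M \<times> carrier N \<Longrightarrow> \<Phi> (basis_elt R b) = case_prod \<beta> b"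
    by blast
  then have \<Phi>_e: "\<Phi> (e m n) = \<beta> m n" if "m \<in> carrier M" "n \<in> carrier N" for m n
    using that by auto
  note \<Phi>D = module_homsD(2-)[OF \<Phi>] and \<Phi>_minus = module_hom_minus[OF module_F P \<Phi>]
  define Ker where "Ker = {f \<in> carrier F. \<Phi> f = \<zero>\<^bsub>P\<^esub>}"
  have "submodule Ker R F"
  proof (rule F.submoduleI)
    show zero: "\<zero>\<^bsub>F\<^esub> \<in> Ker" using module_hom_zero[OF module_F P \<Phi>] F.M.zero_closed by (simp add: Ker_def del: free_module_simps)
    fix a assume a: "a \<in> Ker"
    show "\<ominus>\<^bsub>F\<^esub> a \<in> Ker"
      using \<Phi>_minus[of "\<zero>\<^bsub>F\<^esub>" a] a zero F.M.zero_closed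
      by (simp add: Ker_def a_minus_def F.M.l_zero del: free_module_simps)
  qed (auto simp: Ker_def \<Phi>D)
  moreover have "tensor_relations R M N \<subseteq> Ker"
  proof
    fix x assume x: "x \<in> tensor_relations R M N"
    then have "x \<in> carrier F" using tensor_relations_subset by auto
    moreover have "y \<ominus>\<^bsub>P\<^esub> y = \<zero>\<^bsub>P\<^esub>" if "y \<in> carrier P" for y
      using that by (simp add: a_minus_def P.M.r_neg)
    with x have "\<Phi> x = \<zero>\<^bsub>P\<^esub>"
      by (cases rule: tensor_relations_cases)
        (simp_all add: \<Phi>_minus \<Phi>D \<Phi>_e e_closed closed add_left add_right smult_left smult_right)
    ultimately show "x \<in> Ker" by (simp add: Ker_def)
  qed
  ultimately have K_Ker: "K \<subseteq> Ker" by (rule K_minimal)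
  have \<Phi>_const: "\<Phi> y = \<Phi> x" if x: "x \<in> carrier F" and y: "y \<in> K +>\<^bsub>F\<^esub> x" for x y
  proof -
    obtain n where "n \<in> K" "y = n \<oplus>\<^bsub>F\<^esub> x" using y by (auto simp: a_r_coset_def')
    then show ?thesis using K_Ker x \<Phi>D by (auto simp: Ker_def)
  qed
  \<comment> \<open>The choice of a representative is harmless by
    \<open>\<Phi>_const\<close>.\<close>
  define h where "h = (\<lambda>C\<in>carrier T. \<Phi> (SOME x. x \<in> C))"
  have h: "h (K +>\<^bsub>F\<^esub> x) = \<Phi> x" if x: "x \<in> carrier F" for x
  proof -
    have "x \<in> K +>\<^bsub>F\<^esub> x"
      using abelian_subgroup.a_rcos_self[OF F.abelian_subgroup_submodule[OF submodule_K] x] .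
    then have "(SOME y. y \<in> K +>\<^bsub>F\<^esub> x) \<in> K +>\<^bsub>F\<^esub> x"
      by (rule someI[of "\<lambda>y. y \<in> K +>\<^bsub>F\<^esub> x"])
    then show ?thesis using \<Phi>_const[OF x] x by (simp add: h_def carrier_T)
  qed
  have "h \<in> module_homs R T P"
  proof (rule module_homsI)
    fix r x y assume r: "r \<in> carrier R" and "x \<in> carrier T"
    then obtain f where f: "f \<in> carrier F" "x = K +>\<^bsub>F\<^esub> f" by (auto simp: carrier_T)
    show "h (r \<odot>\<^bsub>T\<^esub> x) = r \<odot>\<^bsub>P\<^esub> h x"
      using f r h[of f] h[of "r \<odot>\<^bsub>F\<^esub> f"] \<Phi>D by (simp add: smult_T)
  next
    fix x y assume "x \<in> carrier T" "y \<in> carrier T"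
    then obtain f g where f: "f \<in> carrier F" "x = K +>\<^bsub>F\<^esub> f" and g: "g \<in> carrier F" "y = K +>\<^bsub>F\<^esub> g"
      by (auto simp: carrier_T)
    show "h (x \<oplus>\<^bsub>T\<^esub> y) = h x \<oplus>\<^bsub>P\<^esub> h y"
      using f g h[of f] h[of g] h[of "f \<oplus>\<^bsub>F\<^esub> g"] \<Phi>D by (simp add: add_T)
  next
    show "h \<in> extensional (carrier T)" by (simp add: h_def)
    show "h x \<in> carrier P" if "x \<in> carrier T" for x
      using that h \<Phi>D by (auto simp: carrier_T)
  qed
  moreover have "h (ten m n) = \<beta> m n" if "m \<in> carrier M" "n \<in> carrier N" for m n
    using that h \<Phi>_e e_closed by (simp add: pure_tensor_def)
  ultimately show ?thesis by blast
qed

lemma tensor_hom_unique: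
  assumes P: "module R P" and h: "h \<in> module_homs R T P" "h' \<in> module_homs R T P"
    and eq: "\<And>m n. m \<in> carrier M \<Longrightarrow> n \<in> carrier N \<Longrightarrow> h (ten m n) = h' (ten m n)"
  shows "h = h'"
proof (rule extensionalityI)
  show "h x = h' x" if "x \<in> carrier T" for x
    using that
  proof (induction x rule: tensor_induct)
    case zero
    show ?case using module_hom_zero[OF module_T P h(1)] module_hom_zero[OF module_T P h(2)] by simp
  qed (use eq module_homsD(3)[OF h(1)] module_homsD(3)[OF h(2)] in auto)
qed (use h module_homsD(1) in auto)

lemma induced_hom:
  assumes P: "module R P"
    and closed: "\<And>m n. m \<in> carrier M \<Longrightarrow> n \<in> carrier N \<Longrightarrow> \<beta> m n \<in> carrier P"
    and add_left: "\<And>m m' n. m \<in> carrier M \<Longrightarrow> m' \<in> carrier M \<Longrightarrow> n \<in> carrier N \<Longrightarrow>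
      \<beta> (m \<oplus>\<^bsub>M\<^esub> m') n = \<beta> m n \<oplus>\<^bsub>P\<^esub> \<beta> m' n"
    and add_right: "\<And>m n n'. m \<in> carrier M \<Longrightarrow> n \<in> carrier N \<Longrightarrow> n' \<in> carrier N \<Longrightarrow>
      \<beta> m (n \<oplus>\<^bsub>N\<^esub> n') = \<beta> m n \<oplus>\<^bsub>P\<^esub> \<beta> m n'"
    and smult_left: "\<And>r m n. r \<in> carrier R \<Longrightarrow> m \<in> carrier M \<Longrightarrow> n \<in> carrier N \<Longrightarrow>
      \<beta> (r \<odot>\<^bsub>M\<^esub> m) n = r \<odot>\<^bsub>P\<^esub> \<beta> m n"
    and smult_right: "\<And>r m n. r \<in> carrier R \<Longrightarrow> m \<in> carrier M \<Longrightarrow> n \<in> carrier N \<Longrightarrow>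
      \<beta> m (r \<odot>\<^bsub>N\<^esub> n) = r \<odot>\<^bsub>P\<^esub> \<beta> m n"
  shows "induced_hom R M N P \<beta> \<in> module_homs R T P"
    and "\<And>m n. m \<in> carrier M \<Longrightarrow> n \<in> carrier N \<Longrightarrow> induced_hom R M N P \<beta> (ten m n) = \<beta> m n"
proof -
  let ?Q = "\<lambda>h. h \<in> module_homs R T P \<and> (\<forall>m\<in>carrier M. \<forall>n\<in>carrier N. h (ten m n) = \<beta> m n)"
  have "\<exists>h. ?Q h" using assms by (rule tensor_hom_ex)
  moreover have "h = h'" if "?Q h" "?Q h'" for h h'
    using that by (intro tensor_hom_unique[OF P]) auto
  ultimately have "\<exists>!h. ?Q h" by blast
  from theI'[OF this] show "induced_hom R M N P \<beta> \<in> module_homs R T P"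
    "\<And>m n. m \<in> carrier M \<Longrightarrow> n \<in> carrier N \<Longrightarrow> induced_hom R M N P \<beta> (ten m n) = \<beta> m n"
    by (simp_all add: induced_hom_def)
qed

text \<open>This is the image of (span of S) \<otimes> N in M \<otimes> N. Working with the image
  avoids the question whether the tensor product of the span embeds, and one coefficient per
  generator makes addition coefficientwise.\<close>

definition ten_sums :: "'m set \<Rightarrow> ('m \<times> 'n \<Rightarrow> 'r) set set" where
  "ten_sums S = {\<Oplus>\<^bsub>T\<^esub>s\<in>S. ten s (r s) | r. r \<in> S \<rightarrow> carrier N}"

context
  fixes S assumes S: "finite S" "S \<subseteq> carrier M"
begin

lemma ten_sums_zero: "\<zero>\<^bsub>T\<^esub> \<in> ten_sums S"
proof -
  \<comment> \<open>Obtained from the empty sum in \<open>ten_finsum_right\<close>;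
    \<open>undefined\<close> stands for a summand that is never evaluated.\<close>
  have "ten s \<zero>\<^bsub>N\<^esub> = \<zero>\<^bsub>T\<^esub>" if "s \<in> S" for s
    using ten_finsum_right[of "{}" undefined s] that S by auto
  then have "(\<Oplus>\<^bsub>T\<^esub>s\<in>S. ten s \<zero>\<^bsub>N\<^esub>) = (\<Oplus>\<^bsub>T\<^esub>s\<in>S. \<zero>\<^bsub>T\<^esub>)"
    by (intro T.M.finsum_cong') auto
  then have "\<zero>\<^bsub>T\<^esub> = (\<Oplus>\<^bsub>T\<^esub>s\<in>S. ten s \<zero>\<^bsub>N\<^esub>)" by simp
  then show ?thesis unfolding ten_sums_def by (intro CollectI exI[of _ "\<lambda>_. \<zero>\<^bsub>N\<^esub>"]) auto
qed

lemma ten_sums_add_eq: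
  assumes "r \<in> S \<rightarrow> carrier N" "r' \<in> S \<rightarrow> carrier N"
  shows "(\<Oplus>\<^bsub>T\<^esub>s\<in>S. ten s (r s)) \<oplus>\<^bsub>T\<^esub> (\<Oplus>\<^bsub>T\<^esub>s\<in>S. ten s (r' s)) = (\<Oplus>\<^bsub>T\<^esub>s\<in>S. ten s (r s \<oplus>\<^bsub>N\<^esub> r' s))"
proof -
  have "(\<Oplus>\<^bsub>T\<^esub>s\<in>S. ten s (r s \<oplus>\<^bsub>N\<^esub> r' s)) = (\<Oplus>\<^bsub>T\<^esub>s\<in>S. ten s (r s) \<oplus>\<^bsub>T\<^esub> ten s (r' s))"
    using assms S by (intro T.M.finsum_cong') (auto simp: Pi_iff ten_add_right ten_closed subset_eq)
  then show ?thesis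
    using assms S by (simp add: T.M.finsum_addf Pi_iff ten_closed subset_eq)
qed

lemma ten_sums_add:
  assumes "x \<in> ten_sums S" "y \<in> ten_sums S"
  shows "x \<oplus>\<^bsub>T\<^esub> y \<in> ten_sums S"
proof -
  obtain r r' where r: "r \<in> S \<rightarrow> carrier N" "r' \<in> S \<rightarrow> carrier N"
    and xy: "x = (\<Oplus>\<^bsub>T\<^esub>s\<in>S. ten s (r s))" "y = (\<Oplus>\<^bsub>T\<^esub>s\<in>S. ten s (r' s))"
    using assms by (auto simp: ten_sums_def)
  show ?thesis
    unfolding xy ten_sums_add_eq[OF r] ten_sums_def
    using r by (intro CollectI exI[of _ "\<lambda>s. r s \<oplus>\<^bsub>N\<^esub> r' s"]) auto
qed

lemma ten_sums_subset: "ten_sums S \<subseteq> carrier T"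
  using S by (auto simp: ten_sums_def Pi_iff ten_closed subset_eq intro!: T.M.finsum_closed)

lemma ten_sums_finsum:
  assumes "finite A" "\<And>a. a \<in> A \<Longrightarrow> f a \<in> ten_sums S"
  shows "(\<Oplus>\<^bsub>T\<^esub>a\<in>A. f a) \<in> ten_sums S"
  using assms
proof (induction A)
  case empty
  show ?case by (simp add: ten_sums_zero)
next
  case (insert a A)
  then have "f a \<in> carrier T" "f \<in> A \<rightarrow> carrier T" using ten_sums_subset by auto
  with insert show ?case by (simp add: ten_sums_add)
qed

text \<open>The coefficients of \<open>m\<close> move across the tensor sign: (c s) \<otimes> n = s
  \<otimes> (c n).\<close>

lemma ten_mem_ten_sums:
  assumes m: "m \<in> combos R M (\<lambda>s. s) S" and n: "n \<in> carrier N"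
  shows "ten m n \<in> ten_sums S"
proof -
  obtain c where c: "c \<in> S \<rightarrow> carrier R" and m: "m = (\<Oplus>\<^bsub>M\<^esub>s\<in>S. c s \<odot>\<^bsub>M\<^esub> s)"
    using m by (auto simp: combos_def)
  have "ten m n = (\<Oplus>\<^bsub>T\<^esub>s\<in>S. ten (c s \<odot>\<^bsub>M\<^esub> s) n)"
    unfolding m using S c n by (intro ten_finsum_left) auto
  also have "\<dots> = (\<Oplus>\<^bsub>T\<^esub>s\<in>S. ten s (c s \<odot>\<^bsub>N\<^esub> n))"
    using S c n by (intro T.M.finsum_cong') (auto simp: Pi_iff subset_eq ten_smult_left ten_smult_right ten_closed)
  finally show ?thesis
    using c n unfolding ten_sums_def by (intro CollectI exI[of _ "\<lambda>s. c s \<odot>\<^bsub>N\<^esub> n"]) auto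
qed

lemma tensor_product_eq_ten_sums:
  assumes gen: "carrier M = combos R M (\<lambda>s. s) S" and x: "x \<in> carrier T"
  shows "x \<in> ten_sums S"
  using x
proof (induction x rule: tensor_induct)
  case (ten m n)
  then show ?case using gen ten_mem_ten_sums by simp
qed (auto simp: ten_sums_zero ten_sums_add)

end

end

section \<open>The comparison map\<close>

lemma (in module) ideal_colon:
  assumes K: "submodule K R M" and g: "g \<in> carrier M"
  shows "ideal {a \<in> carrier R. a \<odot>\<^bsub>M\<^esub> g \<in> K} R" (is "ideal ?I R")
proof (rule idealI)
  show "ring R" by (rule R.ring_axioms)
  note KE = submoduleE[OF K]
  show "subgroup ?I (add_monoid R)"
    using g submodule_zero[OF K] KE(3,5)
    by (intro R.add.subgroupI) (auto simp: a_inv_def[symmetric] smult_l_minus smult_l_distr intro!: exI[of _ \<zero>])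
  fix a x assume "a \<in> ?I" "x \<in> carrier R"
  then show "x \<otimes> a \<in> ?I" using g KE(4) by (simp add: smult_assoc1)
  then show "a \<otimes> x \<in> ?I" using \<open>a \<in> ?I\<close> \<open>x \<in> carrier R\<close> by (simp add: R.m_comm)
qed

text \<open>The hypothesis \<open>colon\<close> is what flatness of \<open>S\<close> over \<open>R\<close> gives for \<open>P = M \<otimes> S\<close>.\<close>

locale base_change =
  M: module R M + P: module S P + noeth: noetherian_ring R
  for R :: "('r, 'c) ring_scheme" and M :: "('r, 'm, 'd) module_scheme"
    and S :: "('s, 'f) ring_scheme" and P :: "('s, 'p, 'g) module_scheme" +
  fixes \<phi> :: "'r \<Rightarrow> 's" and \<sigma> :: "'m \<Rightarrow> 'p"
  assumes \<phi>: "\<phi> \<in> ring_hom R S"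
    and \<sigma>_closed: "x \<in> carrier M \<Longrightarrow> \<sigma> x \<in> carrier P"
    and \<sigma>_add: "x \<in> carrier M \<Longrightarrow> y \<in> carrier M \<Longrightarrow> \<sigma> (x \<oplus>\<^bsub>M\<^esub> y) = \<sigma> x \<oplus>\<^bsub>P\<^esub> \<sigma> y"
    and \<sigma>_smult: "r \<in> carrier R \<Longrightarrow> x \<in> carrier M \<Longrightarrow> \<sigma> (r \<odot>\<^bsub>M\<^esub> x) = \<phi> r \<odot>\<^bsub>P\<^esub> \<sigma> x"
    and colon: "\<lbrakk>finite G; G \<subseteq> carrier M; g \<in> carrier M; finite A; A \<subseteq> carrier R;
      genideal R A = {a \<in> carrier R. a \<odot>\<^bsub>M\<^esub> g \<in> combos R M (\<lambda>s. s) G};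
      t \<in> carrier S; t \<odot>\<^bsub>P\<^esub> \<sigma> g \<in> combos S P \<sigma> G\<rbrakk> \<Longrightarrow> t \<in> combos S (ring_as_module S) \<phi> A"
begin

abbreviation SR :: "('r, 's) module" where "SR \<equiv> restrict_scalars \<phi> (ring_as_module S)"
abbreviation PR :: "('r, 'p) module" where "PR \<equiv> restrict_scalars \<phi> P"
abbreviation \<Omega> :: "('m \<times> 's \<Rightarrow> 'r) set \<Rightarrow> 'p" where
  "\<Omega> \<equiv> induced_hom R M SR PR (\<lambda>m r. r \<odot>\<^bsub>P\<^esub> \<sigma> m)"

lemma module_PR: "module R PR"
  by (intro module_restrict_scalars[OF _ \<phi>] M.R.is_cring P.module_axioms)

sublocale tensor R M SR
  by (intro tensor.intro M.module_axioms module_restrict_scalars[OF _ \<phi>] M.R.is_cring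
      P.R.module_ring_as_module)

lemma \<phi>_closed: "r \<in> carrier R \<Longrightarrow> \<phi> r \<in> carrier S"
  by (rule ring_hom_closed[OF \<phi>])

lemma \<Omega>_hom: "\<Omega> \<in> module_homs R T PR"
  and \<Omega>_ten: "m \<in> carrier M \<Longrightarrow> r \<in> carrier S \<Longrightarrow> \<Omega> (ten m r) = r \<odot>\<^bsub>P\<^esub> \<sigma> m"
proof -
  \<comment> \<open>Commutativity of \<open>S\<close> lets \<open>r\<close> and
    \<open>\<phi> a\<close> trade places; this gives R-linearity of the bilinear map in
    \<open>m\<close>.\<close>
  have *: "r \<odot>\<^bsub>P\<^esub> (\<phi> a \<odot>\<^bsub>P\<^esub> \<sigma> m) = \<phi> a \<odot>\<^bsub>P\<^esub> (r \<odot>\<^bsub>P\<^esub> \<sigma> m)"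
    if "a \<in> carrier R" "m \<in> carrier M" "r \<in> carrier S" for a m r
    using that \<phi>_closed \<sigma>_closed by (metis P.smult_assoc1 P.R.m_comm)
  note induced = induced_hom[OF module_PR, of "\<lambda>m r. r \<odot>\<^bsub>P\<^esub> \<sigma> m"]
  show "\<Omega> \<in> module_homs R T PR"
    by (rule induced) (simp_all add: \<sigma>_closed \<sigma>_add \<sigma>_smult \<phi>_closed * P.smult_r_distr P.smult_l_distr P.smult_assoc1)
  show "m \<in> carrier M \<Longrightarrow> r \<in> carrier S \<Longrightarrow> \<Omega> (ten m r) = r \<odot>\<^bsub>P\<^esub> \<sigma> m"
    by (rule induced) (simp_all add: \<sigma>_closed \<sigma>_add \<sigma>_smult \<phi>_closed * P.smult_r_distr P.smult_l_distr P.smult_assoc1)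
qed

lemma \<Omega>_sum:
  assumes "finite G" "G \<subseteq> carrier M" "r \<in> G \<rightarrow> carrier S"
  shows "\<Omega> (\<Oplus>\<^bsub>T\<^esub>s\<in>G. ten s (r s)) = (\<Oplus>\<^bsub>P\<^esub>s\<in>G. r s \<odot>\<^bsub>P\<^esub> \<sigma> s)"
proof -
  have "\<Omega> (\<Oplus>\<^bsub>T\<^esub>s\<in>G. ten s (r s)) = (\<Oplus>\<^bsub>P\<^esub>s\<in>G. \<Omega> (ten s (r s)))"
    using assms module_hom_finsum[OF module_T module_PR \<Omega>_hom, of G "\<lambda>s. ten s (r s)"]
    by (simp add: Pi_iff subset_eq ten_closed)
  also have "\<dots> = (\<Oplus>\<^bsub>P\<^esub>s\<in>G. r s \<odot>\<^bsub>P\<^esub> \<sigma> s)"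
    using assms by (intro P.M.finsum_cong') (auto simp: \<Omega>_ten \<sigma>_closed Pi_iff subset_eq)
  finally show ?thesis .
qed

text \<open>If \<open>t \<sigma> g\<close> lies in the span of \<open>\<sigma> ` G\<close>, then \<open>t = \<Sum>\<^sub>a c\<^sub>a \<phi> a\<close> with \<open>a g\<close> in the
  span of \<open>G\<close>, and \<open>g \<otimes> t = \<Sum>\<^sub>a a g \<otimes> c\<^sub>a\<close>.\<close>

lemma ten_mem_ten_sums_colon:
  assumes G: "finite G" "G \<subseteq> carrier M" and g: "g \<in> carrier M"
    and t: "t \<in> carrier S" "t \<odot>\<^bsub>P\<^esub> \<sigma> g \<in> combos S P \<sigma> G"
  shows "ten g t \<in> ten_sums G"
proof -
  let ?I = "{a \<in> carrier R. a \<odot>\<^bsub>M\<^esub> g \<in> combos R M (\<lambda>s. s) G}"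
  have "submodule (combos R M (\<lambda>s. s) G) R M"
    using G by (intro M.submodule_combos) auto
  then have "ideal ?I R" using g by (rule M.ideal_colon)
  \<comment> \<open>The Noetherian hypothesis enters here: the ideal \<open>?I\<close> is given as a
    set, and \<open>colon\<close> speaks about finitely many generators of it.\<close>
  then obtain A where A: "A \<subseteq> carrier R" "finite A" "genideal R A = ?I"
    using noeth.finetely_gen[of ?I] by metis
  have AI: "a \<odot>\<^bsub>M\<^esub> g \<in> combos R M (\<lambda>s. s) G" if "a \<in> A" for a
    using M.R.genideal_self[OF A(1)] A(3) that by blast
  obtain c where c: "c \<in> A \<rightarrow> carrier S" and t_eq: "t = (\<Oplus>\<^bsub>S\<^esub>a\<in>A. c a \<otimes>\<^bsub>S\<^esub> \<phi> a)"
    using colon[OF G g A(2,1,3) t] by (auto simp: combos_def)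
  have "ten g t = (\<Oplus>\<^bsub>T\<^esub>a\<in>A. ten g (a \<odot>\<^bsub>SR\<^esub> c a))"
  proof -
    have "t = (\<Oplus>\<^bsub>SR\<^esub>a\<in>A. a \<odot>\<^bsub>SR\<^esub> c a)"
      unfolding t_eq using A c \<phi>_closed
      by (simp add: subset_eq) (intro P.R.finsum_cong'; auto simp: P.R.m_comm Pi_iff)
    moreover have "(\<lambda>a. a \<odot>\<^bsub>SR\<^esub> c a) \<in> A \<rightarrow> carrier SR"
      using A c \<phi>_closed by (simp add: Pi_iff subset_eq)
    ultimately show ?thesis using ten_finsum_right[OF A(2) _ g] by simp
  qed
  also have "\<dots> = (\<Oplus>\<^bsub>T\<^esub>a\<in>A. ten (a \<odot>\<^bsub>M\<^esub> g) (c a))"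
  proof (intro T.M.finsum_cong')
    fix a assume "a \<in> A"
    then have "a \<in> carrier R" "c a \<in> carrier SR" using A c by auto
    with g show "ten g (a \<odot>\<^bsub>SR\<^esub> c a) = ten (a \<odot>\<^bsub>M\<^esub> g) (c a)"
      by (simp only: ten_smult_left ten_smult_right)
  qed (use A c g in \<open>auto simp: ten_closed Pi_iff subset_eq\<close>)
  also have "\<dots> \<in> ten_sums G"
    using A c AI by (intro ten_sums_finsum[OF G] ten_mem_ten_sums[OF G]) auto
  finally show ?thesis .
qed

text \<open>The coefficients are arbitrary in the induction because removing \<open>g\<close>
  replaces \<open>r\<close> by r' + r. No independence of generators is claimed: the coefficients
  may be nonzero although the tensor vanishes.\<close>

lemma ten_sum_eq_zero:
  assumes "finite G" "G \<subseteq> carrier M" "r \<in> G \<rightarrow> carrier S" "(\<Oplus>\<^bsub>P\<^esub>s\<in>G. r s \<odot>\<^bsub>P\<^esub> \<sigma> s) = \<zero>\<^bsub>P\<^esub>"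
  shows "(\<Oplus>\<^bsub>T\<^esub>s\<in>G. ten s (r s)) = \<zero>\<^bsub>T\<^esub>"
  using assms
proof (induction G arbitrary: r)
  case empty
  show ?case by simp
next
  case (insert g G)
  then have G: "finite G" "G \<subseteq> carrier M" "g \<in> carrier M" and r: "r \<in> G \<rightarrow> carrier S" "r g \<in> carrier S" by auto
  let ?y = "\<Oplus>\<^bsub>P\<^esub>s\<in>G. r s \<odot>\<^bsub>P\<^esub> \<sigma> s"
  have y: "?y \<in> combos S P \<sigma> G" using r by (auto simp: combos_def)
  have \<sigma>G: "\<sigma> \<in> G \<rightarrow> carrier P" using G \<sigma>_closed by auto
  have yP: "?y \<in> carrier P" using y P.combos_subset[OF \<sigma>G] by auto
  have "r g \<odot>\<^bsub>P\<^esub> \<sigma> g \<oplus>\<^bsub>P\<^esub> ?y = \<zero>\<^bsub>P\<^esub>"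
    using insert.prems(3) insert.hyps G r \<sigma>_closed by (subst (asm) P.M.finsum_insert) (auto simp: Pi_iff subset_eq)
  then have "r g \<odot>\<^bsub>P\<^esub> \<sigma> g = \<ominus>\<^bsub>P\<^esub> ?y"
    using yP r G \<sigma>_closed by (intro P.M.minus_equality[symmetric]) auto
  also have "\<dots> \<in> combos S P \<sigma> G"
    using P.submoduleE(3)[OF P.submodule_combos[OF G(1) \<sigma>G] y] .
  finally have "ten g (r g) \<in> ten_sums G"
    using G r by (intro ten_mem_ten_sums_colon) auto
  then obtain r' where r': "r' \<in> G \<rightarrow> carrier S" "ten g (r g) = (\<Oplus>\<^bsub>T\<^esub>s\<in>G. ten s (r' s))"
    by (auto simp: ten_sums_def)
  have "(\<Oplus>\<^bsub>T\<^esub>s\<in>insert g G. ten s (r s)) = ten g (r g) \<oplus>\<^bsub>T\<^esub> (\<Oplus>\<^bsub>T\<^esub>s\<in>G. ten s (r s))"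
    using insert.hyps G r by (intro T.M.finsum_insert) (auto simp: ten_closed Pi_iff subset_eq)
  also have "\<dots> = (\<Oplus>\<^bsub>T\<^esub>s\<in>G. ten s (r' s \<oplus>\<^bsub>S\<^esub> r s))"
    using ten_sums_add_eq[OF G(1,2), of r' r] r r' by simp
  finally have eq: "(\<Oplus>\<^bsub>T\<^esub>s\<in>insert g G. ten s (r s)) = (\<Oplus>\<^bsub>T\<^esub>s\<in>G. ten s (r' s \<oplus>\<^bsub>S\<^esub> r s))" .
  have rr': "(\<lambda>s. r' s \<oplus>\<^bsub>S\<^esub> r s) \<in> G \<rightarrow> carrier S" using r r' by auto
  \<comment> \<open>Vanishing in \<open>P\<close> is inherited without computation: both families of
    coefficients give the same tensor, and \<open>\<Omega>\<close> maps it to either sum.\<close>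
  have "(\<Oplus>\<^bsub>P\<^esub>s\<in>G. (r' s \<oplus>\<^bsub>S\<^esub> r s) \<odot>\<^bsub>P\<^esub> \<sigma> s) = \<zero>\<^bsub>P\<^esub>"
    using \<Omega>_sum[OF G(1,2) rr'] \<Omega>_sum[OF _ insert.prems(1,2)] insert.hyps(1) insert.prems(3) eq by simp
  then show ?case using insert.IH[OF G(2) rr'] eq by simp
qed

text \<open>One finite set \<open>G\<close> is used on both sides: as generators of \<open>M\<close>
  it reduces every tensor to a sum over \<open>G\<close>, and through \<open>\<sigma>\<close> it
  spans \<open>P\<close> over \<open>S\<close>, which gives surjectivity.\<close>

lemma \<Omega>_iso:
  assumes G: "finite G" "G \<subseteq> carrier M" and M: "carrier M = combos R M (\<lambda>s. s) G"
    and P: "carrier P = combos S P \<sigma> G"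
  shows "\<Omega> \<in> module_isos R T PR"
proof (rule module_isosI[OF module_T module_PR \<Omega>_hom])
  fix x assume "x \<in> carrier T" and x0: "\<Omega> x = \<zero>\<^bsub>PR\<^esub>"
  then have "x \<in> ten_sums G" using tensor_product_eq_ten_sums[OF G M] by simp
  then obtain r where r: "r \<in> G \<rightarrow> carrier S" "x = (\<Oplus>\<^bsub>T\<^esub>s\<in>G. ten s (r s))"
    by (auto simp: ten_sums_def)
  then show "x = \<zero>\<^bsub>T\<^esub>" using x0 ten_sum_eq_zero[OF G r(1)] \<Omega>_sum[OF G r(1)] by simp
next
  fix y assume "y \<in> carrier PR"
  then obtain r where r: "r \<in> G \<rightarrow> carrier S" "y = (\<Oplus>\<^bsub>P\<^esub>s\<in>G. r s \<odot>\<^bsub>P\<^esub> \<sigma> s)"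
    using P by (auto simp: combos_def)
  then have "\<Omega> (\<Oplus>\<^bsub>T\<^esub>s\<in>G. ten s (r s)) = y" using \<Omega>_sum[OF G r(1)] by simp
  moreover have "(\<Oplus>\<^bsub>T\<^esub>s\<in>G. ten s (r s)) \<in> carrier T"
    using r G by (intro T.M.finsum_closed) (auto simp: ten_closed Pi_iff subset_eq)
  ultimately show "\<exists>x\<in>carrier T. \<Omega> x = y" by blast
qed

end

theorem theorem7p6:
  fixes R :: "('v, 'c) ring_scheme"
    and M :: "('v, 'v, 'd) module_scheme"
    and V :: "'v universe"
    and W :: "'w universe"
    and star :: "'v \<Rightarrow> 'w"
    and h :: enat
  assumes "cring R" and "noetherian_ring R"
    and "module R M" and "finitely_generated_module R M"
    and "enlargement h V W star"
    and "contains_ring_and_module h V R M"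
  shows "Omega V W star R M \<in>
    module_isos R (tensor_product R M (star_ring_mod V W star R)) (star_module_mod V W star R M)"
proof -
  obtain k where k: "enat (k + 5) \<le> h" "carrier R \<subseteq> level V k" "carrier M \<subseteq> level V k"
    using assms(6) by (auto simp: contains_ring_and_module_def)
  interpret module R M by (rule assms)
  interpret star_module_map h V W star k R M
    using k assms(5) by unfold_locales (auto simp: enlargement_def)
  \<comment> \<open>Both the ring homomorphism and the map of modules are \<open>star\<close>, from
    \<open>R\<close> to \<open>sR\<close> and from \<open>M\<close> to \<open>sM\<close>; the
    condition \<open>colon\<close> is \<open>smult_mem_combos_star\<close>.\<close>
  interpret base_change R M sR sM star star
  proof (intro base_change.intro base_change_axioms.intro)
    show "module sR sM" by (rule module_star_module)
    show "star \<in> ring_hom R sR" by (rule star_ring_hom)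
  qed (fact assms module_axioms star_closed star_add star_smult smult_mem_combos_star)+
  obtain G where G: "finite G" "G \<subseteq> carrier M"
    and gen: "\<forall>m\<in>carrier M. \<exists>c\<in>G \<rightarrow> carrier R. m = (\<Oplus>\<^bsub>M\<^esub>s\<in>G. c s \<odot>\<^bsub>M\<^esub> s)"
    using assms(4) by (auto simp: finitely_generated_module_def)
  have M: "carrier M = combos R M (\<lambda>s. s) G"
  proof
    show "carrier M \<subseteq> combos R M (\<lambda>s. s) G" using gen by (auto simp: combos_def)
    show "combos R M (\<lambda>s. s) G \<subseteq> carrier M" using G by (intro combos_subset) auto
  qed
  then have "carrier sM = combos sR sM star G"
    using star_combos[OF G] by simp
  from \<Omega>_iso[OF G M this] show ?thesis
    by (simp add: Omega_def star_ring_mod_def star_module_mod_def omega_def[abs_def])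
qed

end
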